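(* Let $U \colon \mathcal{C} \to \mathcal{A}$ be a topological functor (with possibly large fibers), regarded as the Grothendieck construction of a pseudofunctor $\mathcal{F} \colon \mathcal{A}^{\mathrm{op}} \to \mathsf{CAT}$ whose fibers $\mathcal{F}_a$ are (large-)complete thin categories. If, for every morphism $f \colon a \to b$ of $\mathcal{A}$, the change-of-base functor $\mathcal{F}_f \colon \mathcal{F}_b \to \mathcal{F}_a$ preserves initial objects (bottom elements), then $U \colon \mathcal{C} \to \mathcal{A}$ preserves effective descent morphisms.
   Context: $\mathsf{CAT}$ is the 2-category of (possibly large) categories. Any topological functor $U \colon \mathcal{C}\to\mathcal{A}$ is (up to equivalence over $\mathcal{A}$) the Grothendieck construction of a pseudofunctor $\mathcal{F} \colon \mathcal{A}^{\mathrm{op}} \to \mathsf{CAT}$ which is a bifibration (each $\mathcal{F}_f$ has a left adjoint) and whose fibers $\mathcal{F}_a$ are (large-)complete thin categories, i.e. preorders with all (possibly large) meets, hence also all joins; in particular each $\mathcal{F}_a$ has a bottom element, which is its initial object. The Grothendieck construction of $\mathcal{F}$ is the projection $\int_{\mathcal{A}} \mathcal{F} \to \mathcal{A}$, $(a,x)\mapsto a$, where $\int_{\mathcal{A}} \mathcal{F}$ has as objects the pairs $(a,x)$ with $a \in \mathcal{A}$ and $x \in \mathcal{F}_a$, and as morphisms $(a,x)\to(b,y)$ the pairs $(f,\phi)$ with $f \colon a \to b$ in $\mathcal{A}$ and $\phi \colon x \to \mathcal{F}_f(y)$ in $\mathcal{F}_a$, with the usual composition. A morphism $p \colon a \to b$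 in a category $\mathcal{X}$ is an effective descent morphism if all pullbacks along $p$ exist in $\mathcal{X}$ (equivalently, the functor $p_! \colon \mathcal{X} \downarrow a \to \mathcal{X} \downarrow b$, $f \mapsto p \circ f$, between slice categories has a right adjoint $p^*$) and $p^*$ is monadic (its comparison functor into the Eilenberg-Moore category of the monad induced by $p_! \dashv p^*$ is an equivalence). No existence of other pullbacks in $\mathcal{X}$ is assumed. A functor $F$ preserves effective descent morphisms if $F(p)$ is an effective descent morphism whenever $p$ is. *)

theory Defs
  imports Main
begin

section \<open>Categories, functors, natural transformations\<close>

text \<open>Objects and arrows are sets over arbitrary types; no smallness is imposed anywhere.
  The operations are only meaningful on \<open>Obj\<close> and \<open>Arr\<close>.\<close>

record ('o, 'a) cat =
  Obj :: "'o set"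
  Arr :: "'a set"
  Dom :: "'a \<Rightarrow> 'o"
  Cod :: "'a \<Rightarrow> 'o"
  Ide :: "'o \<Rightarrow> 'a"
  Comp :: "'a \<Rightarrow> 'a \<Rightarrow> 'a"  (infixl "\<cdot>\<index>" 70)

definition Hom :: "('o, 'a, 'z) cat_scheme \<Rightarrow> 'o \<Rightarrow> 'o \<Rightarrow> 'a set" where
  "Hom C x y = {f \<in> Arr C. Dom C f = x \<and> Cod C f = y}"

locale category =
  fixes C :: "('o, 'a) cat"
  assumes dom_obj: "f \<in> Arr C \<Longrightarrow> Dom C f \<in> Obj C"
    and cod_obj: "f \<in> Arr C \<Longrightarrow> Cod C f \<in> Obj C"
    and ide_hom: "x \<in> Obj C \<Longrightarrow> Ide C x \<in> Hom C x x"
    and comp_hom: "f \<in> Hom C x y \<Longrightarrow> g \<in> Hom C y z \<Longrightarrow> g \<cdot>\<^bsub>C\<^esub> f \<in> Hom C x z"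
    and comp_ide_right: "f \<in> Hom C x y \<Longrightarrow> f \<cdot>\<^bsub>C\<^esub> Ide C x = f"
    and comp_ide_left: "f \<in> Hom C x y \<Longrightarrow> Ide C y \<cdot>\<^bsub>C\<^esub> f = f"
    and comp_assoc: "f \<in> Hom C w x \<Longrightarrow> g \<in> Hom C x y \<Longrightarrow> h \<in> Hom C y z \<Longrightarrow>
      (h \<cdot>\<^bsub>C\<^esub> g) \<cdot>\<^bsub>C\<^esub> f = h \<cdot>\<^bsub>C\<^esub> (g \<cdot>\<^bsub>C\<^esub> f)"

definition is_iso :: "('o, 'a) cat \<Rightarrow> 'a \<Rightarrow> bool" where
  "is_iso C f \<longleftrightarrow> f \<in> Arr C \<and>
     (\<exists>g \<in> Hom C (Cod C f) (Dom C f).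
        g \<cdot>\<^bsub>C\<^esub> f = Ide C (Dom C f) \<and> f \<cdot>\<^bsub>C\<^esub> g = Ide C (Cod C f))"

record ('o, 'a, 'p, 'b) fctr =
  FO :: "'o \<Rightarrow> 'p"
  FA :: "'a \<Rightarrow> 'b"

locale is_functor = dom: category C + cod: category D
  for C :: "('o, 'a) cat" and D :: "('p, 'b) cat" +
  fixes F :: "('o, 'a, 'p, 'b) fctr"
  assumes map_obj: "x \<in> Obj C \<Longrightarrow> FO F x \<in> Obj D"
    and map_hom: "f \<in> Hom C x y \<Longrightarrow> FA F f \<in> Hom D (FO F x) (FO F y)"
    and map_ide: "x \<in> Obj C \<Longrightarrow> FA F (Ide C x) = Ide D (FO F x)"
    and map_comp: "f \<in> Hom C x y \<Longrightarrow> g \<in> Hom C y z \<Longrightarrow>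
      FA F (g \<cdot>\<^bsub>C\<^esub> f) = FA F g \<cdot>\<^bsub>D\<^esub> FA F f"

definition id_functor :: "('o, 'a, 'o, 'a) fctr" where
  "id_functor = \<lparr>FO = (\<lambda>x. x), FA = (\<lambda>f. f)\<rparr>"

definition comp_functor ::
    "('p, 'b, 'q, 'c) fctr \<Rightarrow> ('o, 'a, 'p, 'b) fctr \<Rightarrow> ('o, 'a, 'q, 'c) fctr"
    (infixl "\<bullet>" 70) where
  "G \<bullet> F = \<lparr>FO = (\<lambda>x. FO G (FO F x)), FA = (\<lambda>f. FA G (FA F f))\<rparr>"

definition functor_eq ::
    "('o, 'a) cat \<Rightarrow> ('o, 'a, 'p, 'b) fctr \<Rightarrow> ('o, 'a, 'p, 'b) fctr \<Rightarrow> bool" where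
  "functor_eq C F G \<longleftrightarrow>
     (\<forall>x \<in> Obj C. FO F x = FO G x) \<and> (\<forall>f \<in> Arr C. FA F f = FA G f)"

definition nat_trans :: "('o, 'a) cat \<Rightarrow> ('p, 'b) cat \<Rightarrow>
    ('o, 'a, 'p, 'b) fctr \<Rightarrow> ('o, 'a, 'p, 'b) fctr \<Rightarrow> ('o \<Rightarrow> 'b) \<Rightarrow> bool" where
  "nat_trans C D F G \<tau> \<longleftrightarrow>
     (\<forall>x \<in> Obj C. \<tau> x \<in> Hom D (FO F x) (FO G x)) \<and>
     (\<forall>f \<in> Arr C. \<tau> (Cod C f) \<cdot>\<^bsub>D\<^esub> FA F f = FA G f \<cdot>\<^bsub>D\<^esub> \<tau> (Dom C f))"

definition nat_iso :: "('o, 'a) cat \<Rightarrow> ('p, 'b) cat \<Rightarrow>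
    ('o, 'a, 'p, 'b) fctr \<Rightarrow> ('o, 'a, 'p, 'b) fctr \<Rightarrow> ('o \<Rightarrow> 'b) \<Rightarrow> bool" where
  "nat_iso C D F G \<tau> \<longleftrightarrow> nat_trans C D F G \<tau> \<and> (\<forall>x \<in> Obj C. is_iso D (\<tau> x))"

definition is_equivalence ::
    "('o, 'a) cat \<Rightarrow> ('p, 'b) cat \<Rightarrow> ('o, 'a, 'p, 'b) fctr \<Rightarrow> bool" where
  "is_equivalence C D F \<longleftrightarrow> is_functor C D F \<and>
     (\<exists>G \<sigma> \<tau>. is_functor D C G \<and>
        nat_iso C C (G \<bullet> F) id_functor \<sigma> \<and> nat_iso D D (F \<bullet> G) id_functor \<tau>)"

text \<open>Equivalence of \<open>U : C \<rightarrow> A\<close> and \<open>V : D \<rightarrow> A\<close> as objects of the strict slice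
  2-category over \<open>A\<close>: the functors commute with the projections and the natural
  isomorphisms are vertical.\<close>

definition equivalent_over :: "('o, 'a) cat \<Rightarrow> ('p, 'b) cat \<Rightarrow> ('q, 'c) cat \<Rightarrow>
    ('p, 'b, 'o, 'a) fctr \<Rightarrow> ('q, 'c, 'o, 'a) fctr \<Rightarrow> bool" where
  "equivalent_over A C D U V \<longleftrightarrow> is_functor C A U \<and> is_functor D A V \<and>
     (\<exists>E G \<sigma> \<tau>. is_functor C D E \<and> is_functor D C G \<and>
        functor_eq C (V \<bullet> E) U \<and> functor_eq D (U \<bullet> G) V \<and>
        nat_iso C C (G \<bullet> E) id_functor \<sigma> \<and> nat_iso D D (E \<bullet> G) id_functor \<tau> \<and>
        (\<forall>x \<in> Obj C. FA U (\<sigma> x) = Ide A (FO U x)) \<and>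
        (\<forall>y \<in> Obj D. FA V (\<tau> y) = Ide A (FO V y)))"

section \<open>Adjunctions and monadicity\<close>

definition adjunction :: "('o, 'a) cat \<Rightarrow> ('p, 'b) cat \<Rightarrow>
    ('o, 'a, 'p, 'b) fctr \<Rightarrow> ('p, 'b, 'o, 'a) fctr \<Rightarrow> ('o \<Rightarrow> 'a) \<Rightarrow> ('p \<Rightarrow> 'b) \<Rightarrow> bool" where
  "adjunction C D L R \<eta> \<epsilon> \<longleftrightarrow> is_functor C D L \<and> is_functor D C R \<and>
     nat_trans C C id_functor (R \<bullet> L) \<eta> \<and> nat_trans D D (L \<bullet> R) id_functor \<epsilon> \<and>
     (\<forall>x \<in> Obj C. \<epsilon> (FO L x) \<cdot>\<^bsub>D\<^esub> FA L (\<eta> x) = Ide D (FO L x)) \<and>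
     (\<forall>y \<in> Obj D. FA R (\<epsilon> y) \<cdot>\<^bsub>C\<^esub> \<eta> (FO R y) = Ide C (FO R y))"

definition em_algebra :: "('o, 'a) cat \<Rightarrow> ('o, 'a, 'o, 'a) fctr \<Rightarrow> ('o \<Rightarrow> 'a) \<Rightarrow> ('o \<Rightarrow> 'a) \<Rightarrow>
    'o \<Rightarrow> 'a \<Rightarrow> bool" where
  "em_algebra C T \<eta> \<mu> x \<alpha> \<longleftrightarrow> x \<in> Obj C \<and> \<alpha> \<in> Hom C (FO T x) x \<and>
     \<alpha> \<cdot>\<^bsub>C\<^esub> \<eta> x = Ide C x \<and> \<alpha> \<cdot>\<^bsub>C\<^esub> \<mu> x = \<alpha> \<cdot>\<^bsub>C\<^esub> FA T \<alpha>"

text \<open>The Eilenberg-Moore category of a monad \<open>(T, \<eta>, \<mu>)\<close> on \<open>C\<close>; an arrow carries its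
  domain and codomain.\<close>

definition em_category :: "('o, 'a) cat \<Rightarrow> ('o, 'a, 'o, 'a) fctr \<Rightarrow> ('o \<Rightarrow> 'a) \<Rightarrow> ('o \<Rightarrow> 'a) \<Rightarrow>
    ('o \<times> 'a, ('o \<times> 'a) \<times> 'a \<times> ('o \<times> 'a)) cat" where
  "em_category C T \<eta> \<mu> =
    \<lparr>Obj = {(x, \<alpha>). em_algebra C T \<eta> \<mu> x \<alpha>},
     Arr = {((x, \<alpha>), h, (y, \<beta>)) | x \<alpha> h y \<beta>.
              em_algebra C T \<eta> \<mu> x \<alpha> \<and> em_algebra C T \<eta> \<mu> y \<beta> \<and>
              h \<in> Hom C x y \<and> h \<cdot>\<^bsub>C\<^esub> \<alpha> = \<beta> \<cdot>\<^bsub>C\<^esub> FA T h},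
     Dom = (\<lambda>(X, h, Y). X),
     Cod = (\<lambda>(X, h, Y). Y),
     Ide = (\<lambda>X. (X, Ide C (fst X), X)),
     Comp = (\<lambda>(Y, k, Z) (X, h, Y'). (X, k \<cdot>\<^bsub>C\<^esub> h, Z))\<rparr>"

definition adj_em_category :: "('o, 'a) cat \<Rightarrow>
    ('o, 'a, 'p, 'b) fctr \<Rightarrow> ('p, 'b, 'o, 'a) fctr \<Rightarrow> ('o \<Rightarrow> 'a) \<Rightarrow> ('p \<Rightarrow> 'b) \<Rightarrow>
    ('o \<times> 'a, ('o \<times> 'a) \<times> 'a \<times> ('o \<times> 'a)) cat" where
  "adj_em_category C L R \<eta> \<epsilon> = em_category C (R \<bullet> L) \<eta> (\<lambda>x. FA R (\<epsilon> (FO L x)))"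

definition comparison :: "('p, 'b) cat \<Rightarrow> ('p, 'b, 'o, 'a) fctr \<Rightarrow> ('p \<Rightarrow> 'b) \<Rightarrow>
    ('p, 'b, 'o \<times> 'a, ('o \<times> 'a) \<times> 'a \<times> ('o \<times> 'a)) fctr" where
  "comparison D R \<epsilon> =
    \<lparr>FO = (\<lambda>y. (FO R y, FA R (\<epsilon> y))),
     FA = (\<lambda>f. ((FO R (Dom D f), FA R (\<epsilon> (Dom D f))), FA R f,
                (FO R (Cod D f), FA R (\<epsilon> (Cod D f)))))\<rparr>"

definition monadic_adjunction :: "('o, 'a) cat \<Rightarrow> ('p, 'b) cat \<Rightarrow>
    ('o, 'a, 'p, 'b) fctr \<Rightarrow> ('p, 'b, 'o, 'a) fctr \<Rightarrow> ('o \<Rightarrow> 'a) \<Rightarrow> ('p \<Rightarrow> 'b) \<Rightarrow> bool" where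
  "monadic_adjunction C D L R \<eta> \<epsilon> \<longleftrightarrow> adjunction C D L R \<eta> \<epsilon> \<and>
     is_equivalence D (adj_em_category C L R \<eta> \<epsilon>) (comparison D R \<epsilon>)"

section \<open>Slices, pullbacks, effective descent\<close>

text \<open>The object \<open>f\<close> of the slice over \<open>b\<close> is the arrow \<open>f : Dom X f \<rightarrow> b\<close>; an arrow
  \<open>(f, h, g)\<close> is the triangle \<open>g \<cdot> h = f\<close>.\<close>

definition slice :: "('o, 'a) cat \<Rightarrow> 'o \<Rightarrow> ('a, 'a \<times> 'a \<times> 'a) cat" where
  "slice X b =
    \<lparr>Obj = {f \<in> Arr X. Cod X f = b},
     Arr = {(f, h, g). f \<in> Arr X \<and> Cod X f = b \<and> g \<in> Arr X \<and> Cod X g = b \<and>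
              h \<in> Hom X (Dom X f) (Dom X g) \<and> g \<cdot>\<^bsub>X\<^esub> h = f},
     Dom = (\<lambda>(f, h, g). f),
     Cod = (\<lambda>(f, h, g). g),
     Ide = (\<lambda>f. (f, Ide X (Dom X f), f)),
     Comp = (\<lambda>(g, k, l) (f, h, g'). (f, k \<cdot>\<^bsub>X\<^esub> h, l))\<rparr>"

text \<open>The functor \<open>p\<^sub>! : slice X (Dom X p) \<rightarrow> slice X (Cod X p)\<close>.\<close>

definition postcomp :: "('o, 'a) cat \<Rightarrow> 'a \<Rightarrow> ('a, 'a \<times> 'a \<times> 'a, 'a, 'a \<times> 'a \<times> 'a) fctr" where
  "postcomp X p =
    \<lparr>FO = (\<lambda>f. p \<cdot>\<^bsub>X\<^esub> f), FA = (\<lambda>(f, h, g). (p \<cdot>\<^bsub>X\<^esub> f, h, p \<cdot>\<^bsub>X\<^esub> g))\<rparr>"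

definition is_pullback :: "('o, 'a) cat \<Rightarrow> 'a \<Rightarrow> 'a \<Rightarrow> 'a \<Rightarrow> 'a \<Rightarrow> bool" where
  "is_pullback X p f q r \<longleftrightarrow>
     p \<in> Arr X \<and> f \<in> Arr X \<and> Cod X f = Cod X p \<and>
     q \<in> Arr X \<and> r \<in> Hom X (Dom X q) (Dom X f) \<and> Cod X q = Dom X p \<and>
     p \<cdot>\<^bsub>X\<^esub> q = f \<cdot>\<^bsub>X\<^esub> r \<and>
     (\<forall>z \<in> Obj X. \<forall>u \<in> Hom X z (Dom X p). \<forall>v \<in> Hom X z (Dom X f).
        p \<cdot>\<^bsub>X\<^esub> u = f \<cdot>\<^bsub>X\<^esub> v \<longrightarrow>
        (\<exists>!w. w \<in> Hom X z (Dom X q) \<and> q \<cdot>\<^bsub>X\<^esub> w = u \<and> r \<cdot>\<^bsub>X\<^esub> w = v))"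

text \<open>The functor \<open>p\<^sup>*\<close> is a right adjoint of \<open>p\<^sub>!\<close>; it is unique up to isomorphism, and its
  monadicity does not depend on the choice of the adjunction.\<close>

definition effective_descent :: "('o, 'a) cat \<Rightarrow> 'a \<Rightarrow> bool" where
  "effective_descent X p \<longleftrightarrow> p \<in> Arr X \<and>
     (\<forall>f \<in> Arr X. Cod X f = Cod X p \<longrightarrow> (\<exists>q r. is_pullback X p f q r)) \<and>
     (\<exists>R \<eta> \<epsilon>. monadic_adjunction (slice X (Dom X p)) (slice X (Cod X p)) (postcomp X p) R \<eta> \<epsilon>)"

definition preserves_effective_descent ::
    "('o, 'a) cat \<Rightarrow> ('p, 'b) cat \<Rightarrow> ('o, 'a, 'p, 'b) fctr \<Rightarrow> bool" where
  "preserves_effective_descent X Y F \<longleftrightarrow>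
     (\<forall>p. effective_descent X p \<longrightarrow> effective_descent Y (FA F p))"

section \<open>Topological functors\<close>

definition faithful ::
    "('o, 'a) cat \<Rightarrow> ('o, 'a, 'p, 'b) fctr \<Rightarrow> bool" where
  "faithful C U \<longleftrightarrow>
     (\<forall>f \<in> Arr C. \<forall>g \<in> Arr C. Dom C f = Dom C g \<longrightarrow> Cod C f = Cod C g \<longrightarrow>
        FA U f = FA U g \<longrightarrow> f = g)"

text \<open>A \<open>U\<close>-structured source on \<open>a\<close> is given by the set \<open>S\<close> of its members
  \<open>(Y, f : a \<rightarrow> U Y)\<close>; the family \<open>g\<close> with domain \<open>X\<close> is an initial lift of it. Since
  topological functors are required to be faithful, indexing a source by the set of its
  members is no restriction.\<close>

definition structured_source :: "('p, 'b) cat \<Rightarrow> ('o, 'a) cat \<Rightarrow> ('p, 'b, 'o, 'a) fctr \<Rightarrow>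
    'o \<Rightarrow> ('p \<times> 'a) set \<Rightarrow> bool" where
  "structured_source C A U a S \<longleftrightarrow> a \<in> Obj A \<and>
     (\<forall>(Y, f) \<in> S. Y \<in> Obj C \<and> f \<in> Hom A a (FO U Y))"

definition initial_lift :: "('p, 'b) cat \<Rightarrow> ('o, 'a) cat \<Rightarrow> ('p, 'b, 'o, 'a) fctr \<Rightarrow>
    'o \<Rightarrow> ('p \<times> 'a) set \<Rightarrow> 'p \<Rightarrow> ('p \<times> 'a \<Rightarrow> 'b) \<Rightarrow> bool" where
  "initial_lift C A U a S X g \<longleftrightarrow>
     X \<in> Obj C \<and> FO U X = a \<and>
     (\<forall>(Y, f) \<in> S. g (Y, f) \<in> Hom C X Y \<and> FA U (g (Y, f)) = f) \<and>
     (\<forall>Z \<in> Obj C. \<forall>h. \<forall>k \<in> Hom A (FO U Z) a.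
        (\<forall>(Y, f) \<in> S. h (Y, f) \<in> Hom C Z Y \<and> FA U (h (Y, f)) = f \<cdot>\<^bsub>A\<^esub> k) \<longrightarrow>
        (\<exists>!m. m \<in> Hom C Z X \<and> FA U m = k \<and> (\<forall>(Y, f) \<in> S. g (Y, f) \<cdot>\<^bsub>C\<^esub> m = h (Y, f))))"

definition topological_functor ::
    "('p, 'b) cat \<Rightarrow> ('o, 'a) cat \<Rightarrow> ('p, 'b, 'o, 'a) fctr \<Rightarrow> bool" where
  "topological_functor C A U \<longleftrightarrow> is_functor C A U \<and> faithful C U \<and>
     (\<forall>a S. structured_source C A U a S \<longrightarrow> (\<exists>X g. initial_lift C A U a S X g))"

section \<open>Pseudofunctors and the Grothendieck construction\<close>

text \<open>The data of a pseudofunctor from the opposite of \<open>A\<close> to \<open>CAT\<close>: for \<open>f : a \<rightarrow> b\<close> the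
  change-of-base functor \<open>Rex F f : Fib F b \<rightarrow> Fib F a\<close>, and the components
  \<open>Unt F a x : x \<rightarrow> F_(id a) x\<close> and \<open>Mlt F f g x : F_f (F_g x) \<rightarrow> F_(g f) x\<close> of the coherence
  isomorphisms.\<close>

record ('o, 'a, 'x, 'm) pseudo =
  Fib :: "'o \<Rightarrow> ('x, 'm) cat"
  Rex :: "'a \<Rightarrow> ('x, 'm, 'x, 'm) fctr"
  Unt :: "'o \<Rightarrow> 'x \<Rightarrow> 'm"
  Mlt :: "'a \<Rightarrow> 'a \<Rightarrow> 'x \<Rightarrow> 'm"

locale pseudofunctor = category A
  for A :: "('o, 'a) cat" +
  fixes F :: "('o, 'a, 'x, 'm) pseudo"
  assumes fib_category: "a \<in> Obj A \<Longrightarrow> category (Fib F a)"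
    and rex_functor: "f \<in> Hom A a b \<Longrightarrow> is_functor (Fib F b) (Fib F a) (Rex F f)"
    and unt_iso: "a \<in> Obj A \<Longrightarrow>
      nat_iso (Fib F a) (Fib F a) id_functor (Rex F (Ide A a)) (Unt F a)"
    and mlt_iso: "f \<in> Hom A a b \<Longrightarrow> g \<in> Hom A b c \<Longrightarrow>
      nat_iso (Fib F c) (Fib F a) (Rex F f \<bullet> Rex F g) (Rex F (g \<cdot>\<^bsub>A\<^esub> f)) (Mlt F f g)"
    and mlt_unt_left: "f \<in> Hom A a b \<Longrightarrow> x \<in> Obj (Fib F b) \<Longrightarrow>
      Mlt F (Ide A a) f x \<cdot>\<^bsub>Fib F a\<^esub> Unt F a (FO (Rex F f) x) = Ide (Fib F a) (FO (Rex F f) x)"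
    and mlt_unt_right: "f \<in> Hom A a b \<Longrightarrow> x \<in> Obj (Fib F b) \<Longrightarrow>
      Mlt F f (Ide A b) x \<cdot>\<^bsub>Fib F a\<^esub> FA (Rex F f) (Unt F b x) = Ide (Fib F a) (FO (Rex F f) x)"
    and mlt_assoc: "f \<in> Hom A a b \<Longrightarrow> g \<in> Hom A b c \<Longrightarrow> h \<in> Hom A c d \<Longrightarrow>
      x \<in> Obj (Fib F d) \<Longrightarrow>
      Mlt F f (h \<cdot>\<^bsub>A\<^esub> g) x \<cdot>\<^bsub>Fib F a\<^esub> FA (Rex F f) (Mlt F g h x) =
      Mlt F (g \<cdot>\<^bsub>A\<^esub> f) h x \<cdot>\<^bsub>Fib F a\<^esub> Mlt F f g (FO (Rex F h) x)"

definition bifibration :: "('o, 'a) cat \<Rightarrow> ('o, 'a, 'x, 'm) pseudo \<Rightarrow> bool" where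
  "bifibration A F \<longleftrightarrow>
     (\<forall>f \<in> Arr A. \<exists>L \<eta> \<epsilon>.
        adjunction (Fib F (Dom A f)) (Fib F (Cod A f)) L (Rex F f) \<eta> \<epsilon>)"

definition thin :: "('x, 'm) cat \<Rightarrow> bool" where
  "thin P \<longleftrightarrow> (\<forall>f \<in> Arr P. \<forall>g \<in> Arr P. Dom P f = Dom P g \<longrightarrow> Cod P f = Cod P g \<longrightarrow> f = g)"

text \<open>The order of a thin category is nonemptiness of the hom-sets.\<close>

definition has_all_meets :: "('x, 'm) cat \<Rightarrow> bool" where
  "has_all_meets P \<longleftrightarrow>
     (\<forall>S \<subseteq> Obj P. \<exists>m \<in> Obj P. (\<forall>s \<in> S. Hom P m s \<noteq> {}) \<and>
        (\<forall>z \<in> Obj P. (\<forall>s \<in> S. Hom P z s \<noteq> {}) \<longrightarrow> Hom P z m \<noteq> {}))"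

definition complete_thin :: "('x, 'm) cat \<Rightarrow> bool" where
  "complete_thin P \<longleftrightarrow> category P \<and> thin P \<and> has_all_meets P"

definition initial_object :: "('o, 'a) cat \<Rightarrow> 'o \<Rightarrow> bool" where
  "initial_object C x \<longleftrightarrow> x \<in> Obj C \<and> (\<forall>y \<in> Obj C. \<exists>!f. f \<in> Hom C x y)"

definition preserves_initial_objects ::
    "('o, 'a) cat \<Rightarrow> ('p, 'b) cat \<Rightarrow> ('o, 'a, 'p, 'b) fctr \<Rightarrow> bool" where
  "preserves_initial_objects C D F \<longleftrightarrow>
     (\<forall>x. initial_object C x \<longrightarrow> initial_object D (FO F x))"

definition grothendieck :: "('o, 'a) cat \<Rightarrow> ('o, 'a, 'x, 'm) pseudo \<Rightarrow>
    ('o \<times> 'x, ('o \<times> 'x) \<times> ('a \<times> 'm) \<times> ('o \<times> 'x)) cat" where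
  "grothendieck A F =
    \<lparr>Obj = {(a, x). a \<in> Obj A \<and> x \<in> Obj (Fib F a)},
     Arr = {((a, x), (f, \<phi>), (b, y)) | a x f \<phi> b y.
              a \<in> Obj A \<and> x \<in> Obj (Fib F a) \<and> b \<in> Obj A \<and> y \<in> Obj (Fib F b) \<and>
              f \<in> Hom A a b \<and> \<phi> \<in> Hom (Fib F a) x (FO (Rex F f) y)},
     Dom = (\<lambda>(X, h, Y). X),
     Cod = (\<lambda>(X, h, Y). Y),
     Ide = (\<lambda>(a, x). ((a, x), (Ide A a, Unt F a x), (a, x))),
     Comp = (\<lambda>(Y, (g, \<psi>), (c, z)) ((a, x), (f, \<phi>), Y').
       ((a, x),
        (g \<cdot>\<^bsub>A\<^esub> f, Mlt F f g z \<cdot>\<^bsub>Fib F a\<^esub> (FA (Rex F f) \<psi> \<cdot>\<^bsub>Fib F a\<^esub> \<phi>)),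
        (c, z)))\<rparr>"

definition grothendieck_proj ::
    "('o \<times> 'x, ('o \<times> 'x) \<times> ('a \<times> 'm) \<times> ('o \<times> 'x), 'o, 'a) fctr" where
  "grothendieck_proj = \<lparr>FO = fst, FA = (\<lambda>(X, (f, \<phi>), Y). f)\<rparr>"

end

theory Submission
  imports Defs
begin

text \<open>
  A topological functor \<open>U : C \<rightarrow> A\<close> has a left adjoint sending \<open>a\<close> to the discrete object
  \<open>disc a\<close>, the bottom of the fiber over \<open>a\<close>; it can be chosen with \<open>U (disc a) = a\<close>. That
  change of base preserves bottom elements means that discreteness passes to sources: if there is
  an arrow \<open>h : x \<rightarrow> disc e\<close>, then \<open>x\<close> lies below the reindexing of the bottom over \<open>e\<close>, hence is
  itself a bottom element (\<open>grothendieck_source_closed\<close>).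

  Let \<open>p : x \<rightarrow> y\<close> be an effective descent morphism of \<open>C\<close>. An arrow \<open>f : c \<rightarrow> U y\<close> corresponds to
  \<open>disc c \<rightarrow> y\<close>, and since arrows out of \<open>z\<close> in \<open>A\<close> correspond to arrows out of \<open>disc z\<close> in \<open>C\<close>, the
  functor \<open>U\<close> sends a pullback of \<open>disc c \<rightarrow> y\<close> along \<open>p\<close> to a pullback of \<open>f\<close> along \<open>U p\<close>
  (\<open>pullback_of_lift\<close>). The apex of the former has an arrow to \<open>disc c\<close>, so it is discrete again.

  Thus the slices of \<open>A\<close> over \<open>U x\<close> and \<open>U y\<close> are coreflective full subcategories of the slices
  of \<open>C\<close> over \<open>x\<close> and \<open>y\<close>, and both \<open>p\<^sub>!\<close> and \<open>p\<^sup>*\<close> preserve them. The rest is formal and is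
  proved for arbitrary coreflective subcategories (\<open>restricted_monadic\<close>). If \<open>L \<stileturn> R\<close> is monadic,
  restricts along coreflective embeddings \<open>I\<close> with coreflectors \<open>K\<close>, and \<open>R\<close> preserves the
  subcategories, then the restricted adjunction is monadic: algebras of the small monad are the
  algebras of the big one on discrete objects, so fullness and faithfulness of the comparison
  functor restrict (\<open>restricted_fully_faithful\<close>). For essential surjectivity one takes an object
  \<open>y\<close> of the big category whose comparison algebra is the given one and applies \<open>K\<close>: the
  functor \<open>K R\<close> does not distinguish \<open>y\<close> from its coreflection
  (\<open>K_R_delta_iso\<close>, \<open>restricted_essentially_surjective\<close>).
\<close>

section \<open>Arrow calculus\<close>

context category
begin

text \<open>The laws are restated with conditions on domains and codomains in place of hom-sets:
  the conditions then contain no variables besides those of the arrows, so that the simplifier can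
  type compositions by itself.\<close>

lemma dom_cod_obj [simp]:
  assumes "f \<in> Arr C"
  shows "Dom C f \<in> Obj C" and "Cod C f \<in> Obj C"
  using assms dom_obj cod_obj by auto

lemma ide_simps [simp]:
  assumes "x \<in> Obj C"
  shows "Ide C x \<in> Arr C" and "Dom C (Ide C x) = x" and "Cod C (Ide C x) = x"
  using ide_hom [OF assms] by (auto simp: Hom_def)

lemma comp_simps [simp]:
  assumes "f \<in> Arr C" and "g \<in> Arr C" and "Cod C f = Dom C g"
  shows "g \<cdot>\<^bsub>C\<^esub> f \<in> Arr C" and "Dom C (g \<cdot>\<^bsub>C\<^esub> f) = Dom C f" and "Cod C (g \<cdot>\<^bsub>C\<^esub> f) = Cod C g"
  using comp_hom [of f "Dom C f" "Cod C f" g "Cod C g"] assms by (auto simp: Hom_def)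

lemma comp_ide_simps [simp]:
  assumes "f \<in> Arr C"
  shows "Dom C f = x \<Longrightarrow> f \<cdot>\<^bsub>C\<^esub> Ide C x = f" and "Cod C f = y \<Longrightarrow> Ide C y \<cdot>\<^bsub>C\<^esub> f = f"
  using comp_ide_right [of f "Dom C f" "Cod C f"] comp_ide_left [of f "Dom C f" "Cod C f"] assms
  by (auto simp: Hom_def)

lemma assoc:
  assumes "f \<in> Arr C" and "g \<in> Arr C" and "h \<in> Arr C"
    and "Cod C f = Dom C g" and "Cod C g = Dom C h"
  shows "(h \<cdot>\<^bsub>C\<^esub> g) \<cdot>\<^bsub>C\<^esub> f = h \<cdot>\<^bsub>C\<^esub> (g \<cdot>\<^bsub>C\<^esub> f)"
  using comp_assoc [of f "Dom C f" "Cod C f" g "Cod C g" h "Cod C h"] assms by (auto simp: Hom_def)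

lemma iso_inverse:
  assumes "is_iso C i"
  obtains j where "j \<in> Arr C" and "Dom C j = Cod C i" and "Cod C j = Dom C i"
    and "j \<cdot>\<^bsub>C\<^esub> i = Ide C (Dom C i)" and "i \<cdot>\<^bsub>C\<^esub> j = Ide C (Cod C i)"
  using assms by (auto simp: is_iso_def Hom_def)

lemma iso_arr: "is_iso C i \<Longrightarrow> i \<in> Arr C"
  by (simp add: is_iso_def)

lemma isoI:
  assumes "i \<in> Arr C" and "j \<in> Arr C" and "Dom C j = Cod C i" and "Cod C j = Dom C i"
    and "j \<cdot>\<^bsub>C\<^esub> i = Ide C (Dom C i)" and "i \<cdot>\<^bsub>C\<^esub> j = Ide C (Cod C i)"
  shows "is_iso C i"
  using assms by (auto simp: is_iso_def Hom_def)

lemma iso_ide: "x \<in> Obj C \<Longrightarrow> is_iso C (Ide C x)"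
  by (rule isoI [where j = "Ide C x"]) auto

lemma iso_comp:
  assumes i: "is_iso C i" and k: "is_iso C k" and "Cod C i = Dom C k"
  shows "is_iso C (k \<cdot>\<^bsub>C\<^esub> i)"
proof -
  obtain j where j: "j \<in> Arr C" "Dom C j = Cod C i" "Cod C j = Dom C i"
    "j \<cdot>\<^bsub>C\<^esub> i = Ide C (Dom C i)" "i \<cdot>\<^bsub>C\<^esub> j = Ide C (Cod C i)"
    by (rule iso_inverse [OF i])
  obtain l where l: "l \<in> Arr C" "Dom C l = Cod C k" "Cod C l = Dom C k"
    "l \<cdot>\<^bsub>C\<^esub> k = Ide C (Dom C k)" "k \<cdot>\<^bsub>C\<^esub> l = Ide C (Cod C k)"
    by (rule iso_inverse [OF k])
  note a = iso_arr [OF i] iso_arr [OF k]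
  have "(j \<cdot>\<^bsub>C\<^esub> l) \<cdot>\<^bsub>C\<^esub> (k \<cdot>\<^bsub>C\<^esub> i) = j \<cdot>\<^bsub>C\<^esub> ((l \<cdot>\<^bsub>C\<^esub> k) \<cdot>\<^bsub>C\<^esub> i)"
    using a j(1-3) l(1-3) assms(3) by (simp add: assoc)
  moreover have "(k \<cdot>\<^bsub>C\<^esub> i) \<cdot>\<^bsub>C\<^esub> (j \<cdot>\<^bsub>C\<^esub> l) = k \<cdot>\<^bsub>C\<^esub> ((i \<cdot>\<^bsub>C\<^esub> j) \<cdot>\<^bsub>C\<^esub> l)"
    using a j(1-3) l(1-3) assms(3) by (simp add: assoc)
  ultimately show ?thesis
    using a j l assms(3) by (intro isoI [where j = "j \<cdot>\<^bsub>C\<^esub> l"]) auto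
qed

lemma iso_cancel_right:
  assumes i: "is_iso C i" and "f \<in> Arr C" and "g \<in> Arr C" and "Dom C f = Cod C i"
    and "Dom C g = Cod C i" and eq: "f \<cdot>\<^bsub>C\<^esub> i = g \<cdot>\<^bsub>C\<^esub> i"
  shows "f = g"
proof -
  obtain j where j: "j \<in> Arr C" "Dom C j = Cod C i" "Cod C j = Dom C i"
    "i \<cdot>\<^bsub>C\<^esub> j = Ide C (Cod C i)"
    by (rule iso_inverse [OF i])
  have "f \<cdot>\<^bsub>C\<^esub> (i \<cdot>\<^bsub>C\<^esub> j) = g \<cdot>\<^bsub>C\<^esub> (i \<cdot>\<^bsub>C\<^esub> j)"
    using assms(2-5) j(1-3) iso_arr [OF i] eq by (simp flip: assoc)
  then show ?thesis
    using assms(2-5) j by simp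
qed

lemma iso_cancel_left:
  assumes i: "is_iso C i" and "f \<in> Arr C" and "g \<in> Arr C" and "Cod C f = Dom C i"
    and "Cod C g = Dom C i" and eq: "i \<cdot>\<^bsub>C\<^esub> f = i \<cdot>\<^bsub>C\<^esub> g"
  shows "f = g"
proof -
  obtain j where j: "j \<in> Arr C" "Dom C j = Cod C i" "Cod C j = Dom C i"
    "j \<cdot>\<^bsub>C\<^esub> i = Ide C (Dom C i)"
    by (rule iso_inverse [OF i])
  have "(j \<cdot>\<^bsub>C\<^esub> i) \<cdot>\<^bsub>C\<^esub> f = (j \<cdot>\<^bsub>C\<^esub> i) \<cdot>\<^bsub>C\<^esub> g"
    using assms(2-5) j(1-3) iso_arr [OF i] eq by (simp add: assoc)
  then show ?thesis
    using assms(2-5) j by simp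
qed

end

lemma functor_simps [simp]:
  "FO (G \<bullet> F) x = FO G (FO F x)" "FA (G \<bullet> F) f = FA G (FA F f)"
  "FO id_functor x = x" "FA id_functor f = f"
  by (simp_all add: comp_functor_def id_functor_def)

context is_functor
begin

lemma map_simps [simp]:
  "x \<in> Obj C \<Longrightarrow> FO F x \<in> Obj D"
  "f \<in> Arr C \<Longrightarrow> FA F f \<in> Arr D"
  "f \<in> Arr C \<Longrightarrow> Dom D (FA F f) = FO F (Dom C f)"
  "f \<in> Arr C \<Longrightarrow> Cod D (FA F f) = FO F (Cod C f)"
  "x \<in> Obj C \<Longrightarrow> FA F (Ide C x) = Ide D (FO F x)"
  using map_obj map_hom [of f "Dom C f" "Cod C f"] map_ide by (auto simp: Hom_def)

lemma map_comp_arr: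
  assumes "f \<in> Arr C" and "g \<in> Arr C" and "Cod C f = Dom C g"
  shows "FA F (g \<cdot>\<^bsub>C\<^esub> f) = FA F g \<cdot>\<^bsub>D\<^esub> FA F f"
  using map_comp [of f "Dom C f" "Cod C f" g "Cod C g"] assms by (auto simp: Hom_def)

lemma map_iso:
  assumes i: "is_iso C i"
  shows "is_iso D (FA F i)"
proof -
  obtain j where j: "j \<in> Arr C" "Dom C j = Cod C i" "Cod C j = Dom C i"
    "j \<cdot>\<^bsub>C\<^esub> i = Ide C (Dom C i)" "i \<cdot>\<^bsub>C\<^esub> j = Ide C (Cod C i)"
    by (rule dom.iso_inverse [OF i])
  show ?thesis
    using j dom.iso_arr [OF i]
    by (intro cod.isoI [where j = "FA F j"]) (simp_all flip: map_comp_arr)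
qed

end

lemma is_functor_comp:
  assumes "is_functor C D F" and "is_functor D E G"
  shows "is_functor C E (G \<bullet> F)"
proof -
  interpret F: is_functor C D F by fact
  interpret G: is_functor D E G by fact
  show ?thesis
    by unfold_locales
      (auto simp: Hom_def F.map_comp_arr G.map_comp_arr)
qed

section \<open>Equivalences\<close>

definition fully_faithful :: "('o, 'a) cat \<Rightarrow> ('p, 'b) cat \<Rightarrow> ('o, 'a, 'p, 'b) fctr \<Rightarrow> bool" where
  "fully_faithful C D F \<longleftrightarrow>
     (\<forall>x \<in> Obj C. \<forall>y \<in> Obj C. bij_betw (FA F) (Hom C x y) (Hom D (FO F x) (FO F y)))"

definition essentially_surjective ::
    "('o, 'a) cat \<Rightarrow> ('p, 'b) cat \<Rightarrow> ('o, 'a, 'p, 'b) fctr \<Rightarrow> bool" where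
  "essentially_surjective C D F \<longleftrightarrow>
     (\<forall>y \<in> Obj D. \<exists>x \<in> Obj C. \<exists>i \<in> Hom D (FO F x) y. is_iso D i)"

text \<open>A functor with a left inverse up to isomorphism is faithful. For an equivalence this
  applies both to the functor and to its quasi-inverse.\<close>

lemma faithful_if_retract:
  assumes F: "is_functor C D F" and G: "is_functor D C G"
    and s: "nat_iso C C (G \<bullet> F) id_functor \<sigma>"
    and f: "f \<in> Hom C x y" and g: "g \<in> Hom C x y" and eq: "FA F f = FA F g"
  shows "f = g"
proof -
  interpret F: is_functor C D F by fact
  interpret G: is_functor D C G by fact
  have a: "f \<in> Arr C" "g \<in> Arr C" "Dom C f = x" "Dom C g = x" "Cod C f = y" "Cod C g = y"
    and x: "x \<in> Obj C"
    using f g by (auto simp: Hom_def)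
  have i: "is_iso C (\<sigma> x)" "\<sigma> x \<in> Hom C (FO G (FO F x)) x"
    using s x by (auto simp: nat_iso_def nat_trans_def)
  have "\<sigma> y \<cdot>\<^bsub>C\<^esub> FA G (FA F h) = h \<cdot>\<^bsub>C\<^esub> \<sigma> x" if "h \<in> Hom C x y" for h
    using s that by (auto simp: nat_iso_def nat_trans_def Hom_def)
  from this [OF f] this [OF g] eq have "f \<cdot>\<^bsub>C\<^esub> \<sigma> x = g \<cdot>\<^bsub>C\<^esub> \<sigma> x" by simp
  then show ?thesis
    by (rule F.dom.iso_cancel_right [OF i(1), rotated -1]) (use a i in \<open>auto simp: Hom_def\<close>)
qed

text \<open>The arrow \<open>\<sigma> y \<cdot> G k \<cdot> (\<sigma> x)\<^sup>-\<^sup>1\<close> has the same image under \<open>G F\<close> as \<open>k\<close> has under \<open>G\<close>, and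
  \<open>G\<close> is faithful; hence \<open>F\<close> is full.\<close>

lemma equivalence_fully_faithful:
  assumes "is_equivalence C D F"
  shows "fully_faithful C D F"
proof -
  obtain G \<sigma> \<tau> where F: "is_functor C D F" and G: "is_functor D C G"
    and s: "nat_iso C C (G \<bullet> F) id_functor \<sigma>" and t: "nat_iso D D (F \<bullet> G) id_functor \<tau>"
    using assms by (auto simp: is_equivalence_def)
  interpret F: is_functor C D F by fact
  interpret G: is_functor D C G by fact
  have "FA F ` Hom C x y = Hom D (FO F x) (FO F y)" if o: "x \<in> Obj C" "y \<in> Obj C" for x y
  proof (intro set_eqI iffI)
    fix k assume "k \<in> FA F ` Hom C x y"
    then show "k \<in> Hom D (FO F x) (FO F y)" by (auto simp: Hom_def)
  next
    fix k assume k: "k \<in> Hom D (FO F x) (FO F y)"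
    have i: "is_iso C (\<sigma> x)" "\<sigma> x \<in> Arr C" "Dom C (\<sigma> x) = FO G (FO F x)" "Cod C (\<sigma> x) = x"
      "is_iso C (\<sigma> y)" "\<sigma> y \<in> Arr C" "Dom C (\<sigma> y) = FO G (FO F y)" "Cod C (\<sigma> y) = y"
      using s o by (auto simp: nat_iso_def nat_trans_def Hom_def)
    obtain j where j: "j \<in> Arr C" "Dom C j = x" "Cod C j = FO G (FO F x)"
      "j \<cdot>\<^bsub>C\<^esub> \<sigma> x = Ide C (FO G (FO F x))"
      using F.dom.iso_inverse [OF i(1)] i by metis
    define f where "f = \<sigma> y \<cdot>\<^bsub>C\<^esub> (FA G k \<cdot>\<^bsub>C\<^esub> j)"
    have k': "k \<in> Arr D" "Dom D k = FO F x" "Cod D k = FO F y"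
      using k by (auto simp: Hom_def)
    have f: "f \<in> Arr C" "Dom C f = x" "Cod C f = y"
      using i j k' by (simp_all add: f_def)
    have "\<sigma> y \<cdot>\<^bsub>C\<^esub> FA G (FA F f) = f \<cdot>\<^bsub>C\<^esub> \<sigma> x"
      using s f by (auto simp: nat_iso_def nat_trans_def)
    also have "\<dots> = \<sigma> y \<cdot>\<^bsub>C\<^esub> FA G k"
      using i j k' by (simp add: f_def F.dom.assoc)
    finally have "FA G (FA F f) = FA G k"
      by (rule F.dom.iso_cancel_left [OF i(5), rotated -1]) (use f k' i in auto)
    then have "FA F f = k"
      by (rule faithful_if_retract [OF G F t _ k, rotated]) (use f in \<open>auto simp: Hom_def\<close>)
    then show "k \<in> FA F ` Hom C x y"
      using f by (force simp: Hom_def)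
  qed
  moreover have "inj_on (FA F) (Hom C x y)" for x y
    by (rule inj_onI) (rule faithful_if_retract [OF F G s])
  ultimately show ?thesis
    by (simp add: fully_faithful_def bij_betw_def)
qed

lemma equivalence_essentially_surjective:
  assumes "is_equivalence C D F"
  shows "essentially_surjective C D F"
proof -
  obtain G \<tau> where G: "is_functor D C G" and t: "nat_iso D D (F \<bullet> G) id_functor \<tau>"
    using assms by (auto simp: is_equivalence_def)
  interpret G: is_functor D C G by fact
  show ?thesis
    unfolding essentially_surjective_def
  proof
    fix y assume y: "y \<in> Obj D"
    with t have "\<tau> y \<in> Hom D (FO F (FO G y)) y" "is_iso D (\<tau> y)"
      by (auto simp: nat_iso_def nat_trans_def)
    with G.map_obj [OF y] show "\<exists>x \<in> Obj C. \<exists>i \<in> Hom D (FO F x) y. is_iso D i" by blast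
  qed
qed

lemma (in is_functor) fully_faithful_arr_eq:
  assumes "fully_faithful C D F" and "f \<in> Arr C" and "g \<in> Arr C"
    and "Dom C f = Dom C g" and "Cod C f = Cod C g" and "FA F f = FA F g"
  shows "f = g"
proof -
  have "inj_on (FA F) (Hom C (Dom C g) (Cod C g))"
    using assms by (auto simp: fully_faithful_def bij_betw_def)
  with assms show ?thesis
    by (auto simp: inj_on_def Hom_def)
qed

lemma (in is_functor) fully_faithful_obtain:
  assumes "fully_faithful C D F" and "x \<in> Obj C" and "y \<in> Obj C"
    and "k \<in> Hom D (FO F x) (FO F y)"
  obtains f where "f \<in> Arr C" and "Dom C f = x" and "Cod C f = y" and "FA F f = k"
proof -
  have "k \<in> FA F ` Hom C x y"
    using assms by (auto simp: fully_faithful_def bij_betw_def)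
  with that show ?thesis by (auto simp: Hom_def)
qed

lemma (in is_functor) fully_faithful_reflects_iso:
  assumes ff: "fully_faithful C D F" and f: "f \<in> Arr C" and i: "is_iso D (FA F f)"
  shows "is_iso C f"
proof -
  obtain j where j: "j \<in> Arr D" "Dom D j = FO F (Cod C f)" "Cod D j = FO F (Dom C f)"
    "j \<cdot>\<^bsub>D\<^esub> FA F f = Ide D (FO F (Dom C f))" "FA F f \<cdot>\<^bsub>D\<^esub> j = Ide D (FO F (Cod C f))"
    using cod.iso_inverse [OF i] f by (metis map_simps(3,4))
  obtain g where g: "g \<in> Arr C" "Dom C g = Cod C f" "Cod C g = Dom C f" "FA F g = j"
    by (rule fully_faithful_obtain [OF ff, of "Cod C f" "Dom C f" j])
      (use f j in \<open>auto simp: Hom_def\<close>)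
  have "g \<cdot>\<^bsub>C\<^esub> f = Ide C (Dom C f)"
    by (rule fully_faithful_arr_eq [OF ff]) (use f g j in \<open>auto simp: map_comp_arr\<close>)
  moreover have "f \<cdot>\<^bsub>C\<^esub> g = Ide C (Cod C f)"
    by (rule fully_faithful_arr_eq [OF ff]) (use f g j in \<open>auto simp: map_comp_arr\<close>)
  ultimately show ?thesis
    using f g by (intro dom.isoI [where j = g]) auto
qed

text \<open>A quasi-inverse is built from chosen preimages: \<open>i y : F (G\<^sub>0 y) \<rightarrow> y\<close> with inverse \<open>j y\<close>, and
  \<open>G\<^sub>1 f\<close> the preimage of the conjugate \<open>j \<cdot> f \<cdot> i\<close>. All equations in \<open>C\<close> are checked after
  applying the faithful \<open>F\<close>.\<close>

lemma (in is_functor) equivalenceI: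
  assumes ff: "fully_faithful C D F" and es: "essentially_surjective C D F"
  shows "is_equivalence C D F"
proof -
  have "\<forall>y \<in> Obj D. \<exists>x. x \<in> Obj C \<and> (\<exists>i \<in> Hom D (FO F x) y. is_iso D i)"
    using es unfolding essentially_surjective_def by blast
  from bchoice [OF this] obtain G0
    where G0': "\<forall>y \<in> Obj D. G0 y \<in> Obj C \<and> (\<exists>i \<in> Hom D (FO F (G0 y)) y. is_iso D i)" ..
  then have G0 [simp]: "G0 y \<in> Obj C" if "y \<in> Obj D" for y
    using that by blast
  from G0' have "\<forall>y \<in> Obj D. \<exists>i. i \<in> Hom D (FO F (G0 y)) y \<and> is_iso D i"
    by blast
  from bchoice [OF this] obtain i
    where i': "\<forall>y \<in> Obj D. i y \<in> Hom D (FO F (G0 y)) y \<and> is_iso D (i y)" ..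
  then have i: "is_iso D (i y)"
    and dom_cod_i [simp]: "Dom D (i y) = FO F (G0 y)" "Cod D (i y) = y" if "y \<in> Obj D" for y
    using that by (auto simp: Hom_def)
  have "\<forall>y \<in> Obj D. \<exists>j. j \<in> Arr D \<and> Dom D j = y \<and> Cod D j = FO F (G0 y) \<and>
      j \<cdot>\<^bsub>D\<^esub> i y = Ide D (FO F (G0 y)) \<and> i y \<cdot>\<^bsub>D\<^esub> j = Ide D y"
  proof
    fix y assume y: "y \<in> Obj D"
    obtain j where "j \<in> Arr D" "Dom D j = Cod D (i y)" "Cod D j = Dom D (i y)"
        "j \<cdot>\<^bsub>D\<^esub> i y = Ide D (Dom D (i y))" "i y \<cdot>\<^bsub>D\<^esub> j = Ide D (Cod D (i y))"
      by (rule cod.iso_inverse [OF i [OF y]])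
    with y show "\<exists>j. j \<in> Arr D \<and> Dom D j = y \<and> Cod D j = FO F (G0 y) \<and>
        j \<cdot>\<^bsub>D\<^esub> i y = Ide D (FO F (G0 y)) \<and> i y \<cdot>\<^bsub>D\<^esub> j = Ide D y"
      by auto
  qed
  from bchoice [OF this] obtain j where j':
    "\<forall>y \<in> Obj D. j y \<in> Arr D \<and> Dom D (j y) = y \<and> Cod D (j y) = FO F (G0 y) \<and>
      j y \<cdot>\<^bsub>D\<^esub> i y = Ide D (FO F (G0 y)) \<and> i y \<cdot>\<^bsub>D\<^esub> j y = Ide D y" ..
  then have j [simp]: "j y \<in> Arr D" "Dom D (j y) = y" "Cod D (j y) = FO F (G0 y)"
    and ji [simp]: "j y \<cdot>\<^bsub>D\<^esub> i y = Ide D (FO F (G0 y))" "i y \<cdot>\<^bsub>D\<^esub> j y = Ide D y"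
    if "y \<in> Obj D" for y
    using that by blast+
  have i_arr [simp]: "i y \<in> Arr D" if "y \<in> Obj D" for y
    using i [OF that] by (rule cod.iso_arr)
  have "\<forall>f \<in> Arr D. \<exists>g. g \<in> Arr C \<and> Dom C g = G0 (Dom D f) \<and> Cod C g = G0 (Cod D f) \<and>
      FA F g = j (Cod D f) \<cdot>\<^bsub>D\<^esub> (f \<cdot>\<^bsub>D\<^esub> i (Dom D f))"
  proof
    fix f assume "f \<in> Arr D"
    then obtain g where "g \<in> Arr C" "Dom C g = G0 (Dom D f)" "Cod C g = G0 (Cod D f)"
        "FA F g = j (Cod D f) \<cdot>\<^bsub>D\<^esub> (f \<cdot>\<^bsub>D\<^esub> i (Dom D f))"
      by - (rule fully_faithful_obtain [OF ff, of "G0 (Dom D f)" "G0 (Cod D f)"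
            "j (Cod D f) \<cdot>\<^bsub>D\<^esub> (f \<cdot>\<^bsub>D\<^esub> i (Dom D f))"], simp_all add: Hom_def)
    then show "\<exists>g. g \<in> Arr C \<and> Dom C g = G0 (Dom D f) \<and> Cod C g = G0 (Cod D f) \<and>
        FA F g = j (Cod D f) \<cdot>\<^bsub>D\<^esub> (f \<cdot>\<^bsub>D\<^esub> i (Dom D f))"
      by blast
  qed
  from bchoice [OF this] obtain G1 where G1': "\<forall>f \<in> Arr D.
      G1 f \<in> Arr C \<and> Dom C (G1 f) = G0 (Dom D f) \<and> Cod C (G1 f) = G0 (Cod D f) \<and>
      FA F (G1 f) = j (Cod D f) \<cdot>\<^bsub>D\<^esub> (f \<cdot>\<^bsub>D\<^esub> i (Dom D f))" ..
  then have G1 [simp]: "G1 f \<in> Arr C" "Dom C (G1 f) = G0 (Dom D f)" "Cod C (G1 f) = G0 (Cod D f)"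
    and FG1: "FA F (G1 f) = j (Cod D f) \<cdot>\<^bsub>D\<^esub> (f \<cdot>\<^bsub>D\<^esub> i (Dom D f))" if "f \<in> Arr D" for f
    using that by auto
  have nat: "i (Cod D f) \<cdot>\<^bsub>D\<^esub> FA F (G1 f) = f \<cdot>\<^bsub>D\<^esub> i (Dom D f)" if "f \<in> Arr D" for f
    using that by (simp add: FG1 flip: cod.assoc)
  define G where "G = \<lparr>FO = G0, FA = G1\<rparr>"
  have [simp]: "FO G = G0" "FA G = G1" by (simp_all add: G_def)
  have G1_comp: "G1 (g \<cdot>\<^bsub>D\<^esub> f) = G1 g \<cdot>\<^bsub>C\<^esub> G1 f"
    if "f \<in> Arr D" "g \<in> Arr D" "Cod D f = Dom D g" for f g
  proof (rule fully_faithful_arr_eq [OF ff])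
    have "i (Cod D g) \<cdot>\<^bsub>D\<^esub> FA F (G1 (g \<cdot>\<^bsub>D\<^esub> f)) = (g \<cdot>\<^bsub>D\<^esub> f) \<cdot>\<^bsub>D\<^esub> i (Dom D f)"
      using that nat [of "g \<cdot>\<^bsub>D\<^esub> f"] by simp
    also have "\<dots> = g \<cdot>\<^bsub>D\<^esub> (i (Cod D f) \<cdot>\<^bsub>D\<^esub> FA F (G1 f))"
      using that nat [of f] by (simp add: cod.assoc)
    also have "\<dots> = (i (Cod D g) \<cdot>\<^bsub>D\<^esub> FA F (G1 g)) \<cdot>\<^bsub>D\<^esub> FA F (G1 f)"
      using that nat [of g] by (simp flip: cod.assoc)
    also have "\<dots> = i (Cod D g) \<cdot>\<^bsub>D\<^esub> FA F (G1 g \<cdot>\<^bsub>C\<^esub> G1 f)"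
      using that by (simp add: map_comp_arr cod.assoc)
    finally show "FA F (G1 (g \<cdot>\<^bsub>D\<^esub> f)) = FA F (G1 g \<cdot>\<^bsub>C\<^esub> G1 f)"
      by (rule cod.iso_cancel_left [OF i, rotated -1]) (use that in auto)
  qed (use that in auto)
  have G: "is_functor D C G"
  proof unfold_locales
    fix y assume "y \<in> Obj D"
    then show "FA G (Ide D y) = Ide C (FO G y)"
      by (intro fully_faithful_arr_eq [OF ff]) (auto simp: FG1)
  qed (auto simp: Hom_def G1_comp)
  have "\<forall>x \<in> Obj C. \<exists>s. s \<in> Arr C \<and> Dom C s = G0 (FO F x) \<and> Cod C s = x \<and>
      FA F s = i (FO F x)"
  proof
    fix x assume "x \<in> Obj C"
    then obtain s where "s \<in> Arr C" "Dom C s = G0 (FO F x)" "Cod C s = x" "FA F s = i (FO F x)"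
      by - (rule fully_faithful_obtain [OF ff, of "G0 (FO F x)" x "i (FO F x)"],
          simp_all add: Hom_def)
    then show "\<exists>s. s \<in> Arr C \<and> Dom C s = G0 (FO F x) \<and> Cod C s = x \<and> FA F s = i (FO F x)"
      by blast
  qed
  from bchoice [OF this] obtain \<sigma> where s': "\<forall>x \<in> Obj C.
      \<sigma> x \<in> Arr C \<and> Dom C (\<sigma> x) = G0 (FO F x) \<and> Cod C (\<sigma> x) = x \<and> FA F (\<sigma> x) = i (FO F x)" ..
  then have s [simp]: "\<sigma> x \<in> Arr C" "Dom C (\<sigma> x) = G0 (FO F x)" "Cod C (\<sigma> x) = x"
      "FA F (\<sigma> x) = i (FO F x)" if "x \<in> Obj C" for x
    using that by auto
  have "\<sigma> (Cod C f) \<cdot>\<^bsub>C\<^esub> G1 (FA F f) = f \<cdot>\<^bsub>C\<^esub> \<sigma> (Dom C f)" if "f \<in> Arr C" for f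
    using that nat [of "FA F f"]
    by (intro fully_faithful_arr_eq [OF ff]) (auto simp: map_comp_arr)
  moreover have "is_iso C (\<sigma> x)" if "x \<in> Obj C" for x
    using that by (intro fully_faithful_reflects_iso [OF ff]) (auto intro: i)
  ultimately have "nat_iso C C (G \<bullet> F) id_functor \<sigma>"
    by (auto simp: nat_iso_def nat_trans_def Hom_def)
  moreover have "nat_iso D D (F \<bullet> G) id_functor i"
    using i nat by (auto simp: nat_iso_def nat_trans_def Hom_def)
  moreover have "is_functor C D F"
    by unfold_locales
  ultimately show ?thesis
    using G unfolding is_equivalence_def by blast
qed

section \<open>Adjunctions and their algebras\<close>

locale adjoint_pair =
  fixes C :: "('o, 'a) cat" and D :: "('p, 'b) cat"
    and L :: "('o, 'a, 'p, 'b) fctr" and R :: "('p, 'b, 'o, 'a) fctr"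
    and \<eta> :: "'o \<Rightarrow> 'a" and \<epsilon> :: "'p \<Rightarrow> 'b"
  assumes adj: "adjunction C D L R \<eta> \<epsilon>"
begin

sublocale L: is_functor C D L
  using adj by (simp add: adjunction_def)

sublocale R: is_functor D C R
  using adj by (simp add: adjunction_def)

lemma unit_simps [simp]:
  assumes "x \<in> Obj C"
  shows "\<eta> x \<in> Arr C" and "Dom C (\<eta> x) = x" and "Cod C (\<eta> x) = FO R (FO L x)"
  using adj assms by (auto simp: adjunction_def nat_trans_def Hom_def)

lemma counit_simps [simp]:
  assumes "y \<in> Obj D"
  shows "\<epsilon> y \<in> Arr D" and "Dom D (\<epsilon> y) = FO L (FO R y)" and "Cod D (\<epsilon> y) = y"
  using adj assms by (auto simp: adjunction_def nat_trans_def Hom_def)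

lemma unit_natural:
  "f \<in> Arr C \<Longrightarrow> \<eta> (Cod C f) \<cdot>\<^bsub>C\<^esub> f = FA R (FA L f) \<cdot>\<^bsub>C\<^esub> \<eta> (Dom C f)"
  using adj by (auto simp: adjunction_def nat_trans_def)

lemma counit_natural:
  "f \<in> Arr D \<Longrightarrow> \<epsilon> (Cod D f) \<cdot>\<^bsub>D\<^esub> FA L (FA R f) = f \<cdot>\<^bsub>D\<^esub> \<epsilon> (Dom D f)"
  using adj by (auto simp: adjunction_def nat_trans_def)

lemma triangle_left [simp]:
  "x \<in> Obj C \<Longrightarrow> \<epsilon> (FO L x) \<cdot>\<^bsub>D\<^esub> FA L (\<eta> x) = Ide D (FO L x)"
  using adj by (auto simp: adjunction_def)

lemma triangle_right [simp]:
  "y \<in> Obj D \<Longrightarrow> FA R (\<epsilon> y) \<cdot>\<^bsub>C\<^esub> \<eta> (FO R y) = Ide C (FO R y)"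
  using adj by (auto simp: adjunction_def)

text \<open>This is \<open>em_algebra\<close> for the monad \<open>R L\<close>, with the hom-set conditions unfolded as in the
  arrow calculus above.\<close>

definition algebra :: "'o \<Rightarrow> 'a \<Rightarrow> bool" where
  "algebra x \<alpha> \<longleftrightarrow> x \<in> Obj C \<and> \<alpha> \<in> Arr C \<and> Dom C \<alpha> = FO R (FO L x) \<and> Cod C \<alpha> = x \<and>
     \<alpha> \<cdot>\<^bsub>C\<^esub> \<eta> x = Ide C x \<and> \<alpha> \<cdot>\<^bsub>C\<^esub> FA R (\<epsilon> (FO L x)) = \<alpha> \<cdot>\<^bsub>C\<^esub> FA R (FA L \<alpha>)"

abbreviation EM where "EM \<equiv> adj_em_category C L R \<eta> \<epsilon>"

lemma EM_simps [simp]: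
  "X \<in> Obj EM \<longleftrightarrow> algebra (fst X) (snd X)"
  "(X, h, Y) \<in> Arr EM \<longleftrightarrow> algebra (fst X) (snd X) \<and> algebra (fst Y) (snd Y) \<and>
     h \<in> Arr C \<and> Dom C h = fst X \<and> Cod C h = fst Y \<and>
     h \<cdot>\<^bsub>C\<^esub> snd X = snd Y \<cdot>\<^bsub>C\<^esub> FA R (FA L h)"
  "Dom EM (X, h, Y) = X" "Cod EM (X, h, Y) = Y" "Ide EM X = (X, Ide C (fst X), X)"
  "(Y', k, Z) \<cdot>\<^bsub>EM\<^esub> (X, h, Y) = (X, k \<cdot>\<^bsub>C\<^esub> h, Z)"
  by (cases X; cases Y;
      auto simp: adj_em_category_def em_category_def em_algebra_def algebra_def Hom_def)+

lemma algebra_structure [simp]: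
  assumes "algebra x \<alpha>"
  shows "x \<in> Obj C" and "\<alpha> \<in> Arr C" and "Dom C \<alpha> = FO R (FO L x)" and "Cod C \<alpha> = x"
    and "\<alpha> \<cdot>\<^bsub>C\<^esub> \<eta> x = Ide C x"
  using assms by (auto simp: algebra_def)

lemma algebra_hom_comp:
  assumes "algebra x \<alpha>" "algebra y \<beta>" "algebra z \<gamma>"
    and h: "h \<in> Arr C" "Dom C h = x" "Cod C h = y" "h \<cdot>\<^bsub>C\<^esub> \<alpha> = \<beta> \<cdot>\<^bsub>C\<^esub> FA R (FA L h)"
    and k: "k \<in> Arr C" "Dom C k = y" "Cod C k = z" "k \<cdot>\<^bsub>C\<^esub> \<beta> = \<gamma> \<cdot>\<^bsub>C\<^esub> FA R (FA L k)"
  shows "(k \<cdot>\<^bsub>C\<^esub> h) \<cdot>\<^bsub>C\<^esub> \<alpha> = \<gamma> \<cdot>\<^bsub>C\<^esub> FA R (FA L (k \<cdot>\<^bsub>C\<^esub> h))"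
proof -
  have "(k \<cdot>\<^bsub>C\<^esub> h) \<cdot>\<^bsub>C\<^esub> \<alpha> = k \<cdot>\<^bsub>C\<^esub> (\<beta> \<cdot>\<^bsub>C\<^esub> FA R (FA L h))"
    using assms(1-3) h k(1-3) by (simp add: L.dom.assoc)
  also have "\<dots> = (\<gamma> \<cdot>\<^bsub>C\<^esub> FA R (FA L k)) \<cdot>\<^bsub>C\<^esub> FA R (FA L h)"
    using assms(1-3) h(1-3) k by (simp flip: L.dom.assoc)
  also have "\<dots> = \<gamma> \<cdot>\<^bsub>C\<^esub> FA R (FA L (k \<cdot>\<^bsub>C\<^esub> h))"
    using assms(1-3) h(1-3) k(1-3) by (simp add: L.map_comp_arr R.map_comp_arr L.dom.assoc)
  finally show ?thesis .
qed

lemma category_EM: "category EM"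
proof unfold_locales
  fix f x y g z
  assume "f \<in> Hom EM x y" and "g \<in> Hom EM y z"
  then show "g \<cdot>\<^bsub>EM\<^esub> f \<in> Hom EM x z"
    by (cases f; cases g) (auto simp: Hom_def intro: algebra_hom_comp)
next
  fix f x y g z h w
  assume "f \<in> Hom EM w x" and "g \<in> Hom EM x y" and "h \<in> Hom EM y z"
  then show "(h \<cdot>\<^bsub>EM\<^esub> g) \<cdot>\<^bsub>EM\<^esub> f = h \<cdot>\<^bsub>EM\<^esub> (g \<cdot>\<^bsub>EM\<^esub> f)"
    by (cases f; cases g; cases h) (auto simp: Hom_def L.dom.assoc)
next
  fix f assume "f \<in> Arr EM"
  then show "Dom EM f \<in> Obj EM" "Cod EM f \<in> Obj EM"
    by (cases f; auto)+
next
  fix f x y assume "f \<in> Hom EM x y"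
  then show "f \<cdot>\<^bsub>EM\<^esub> Ide EM x = f" "Ide EM y \<cdot>\<^bsub>EM\<^esub> f = f"
    by (cases f; auto simp: Hom_def)+
qed (auto simp: Hom_def)

text \<open>Naturality of the counit makes \<open>R f\<close> a morphism of the algebras \<open>R \<epsilon>\<close>; for \<open>f = \<epsilon> y\<close> the
  same equation is the associativity law of the algebra \<open>R (\<epsilon> y)\<close>.\<close>

lemma comparison_arr:
  assumes f: "f \<in> Arr D"
  shows "FA R f \<cdot>\<^bsub>C\<^esub> FA R (\<epsilon> (Dom D f)) = FA R (\<epsilon> (Cod D f)) \<cdot>\<^bsub>C\<^esub> FA R (FA L (FA R f))"
proof -
  have "FA R (f \<cdot>\<^bsub>D\<^esub> \<epsilon> (Dom D f)) = FA R (\<epsilon> (Cod D f) \<cdot>\<^bsub>D\<^esub> FA L (FA R f))"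
    by (simp only: counit_natural [OF f])
  then show ?thesis
    using f by (simp add: R.map_comp_arr)
qed

lemma algebra_counit:
  assumes "y \<in> Obj D"
  shows "algebra (FO R y) (FA R (\<epsilon> y))"
  using assms comparison_arr [of "\<epsilon> y"] unfolding algebra_def
  by simp

lemma comparison_simps [simp]:
  "FO (comparison D R \<epsilon>) y = (FO R y, FA R (\<epsilon> y))"
  "FA (comparison D R \<epsilon>) f = ((FO R (Dom D f), FA R (\<epsilon> (Dom D f))), FA R f,
     (FO R (Cod D f), FA R (\<epsilon> (Cod D f))))"
  by (simp_all add: comparison_def)

lemma comparison_functor: "is_functor D EM (comparison D R \<epsilon>)"
proof -
  interpret EM: category EM by (rule category_EM)
  show ?thesis
  proof unfold_locales
    fix f x y assume "f \<in> Hom D x y"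
    then show "FA (comparison D R \<epsilon>) f \<in>
        Hom EM (FO (comparison D R \<epsilon>) x) (FO (comparison D R \<epsilon>) y)"
      by (auto simp: Hom_def algebra_counit comparison_arr)
  next
    fix f x y g z assume "f \<in> Hom D x y" and "g \<in> Hom D y z"
    then show "FA (comparison D R \<epsilon>) (g \<cdot>\<^bsub>D\<^esub> f) =
        FA (comparison D R \<epsilon>) g \<cdot>\<^bsub>EM\<^esub> FA (comparison D R \<epsilon>) f"
      by (simp add: Hom_def R.map_comp_arr)
  qed (simp_all add: algebra_counit)
qed

text \<open>The inverse of an invertible algebra morphism is automatically compatible with the
  structure maps.\<close>

lemma algebra_iso:
  assumes a: "algebra x \<alpha>" "algebra y \<beta>" and i: "is_iso C h"
    and h: "Dom C h = x" "Cod C h = y" "h \<cdot>\<^bsub>C\<^esub> \<alpha> = \<beta> \<cdot>\<^bsub>C\<^esub> FA R (FA L h)"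
  shows "is_iso EM ((x, \<alpha>), h, (y, \<beta>))"
proof -
  interpret EM: category EM by (rule category_EM)
  obtain j where j: "j \<in> Arr C" "Dom C j = y" "Cod C j = x"
    "j \<cdot>\<^bsub>C\<^esub> h = Ide C x" "h \<cdot>\<^bsub>C\<^esub> j = Ide C y"
    by (rule L.dom.iso_inverse [OF i, unfolded h(1,2)])
  note h' = L.dom.iso_arr [OF i]
  have "h \<cdot>\<^bsub>C\<^esub> (j \<cdot>\<^bsub>C\<^esub> \<beta>) = \<beta>"
    using a h h' j by (simp flip: L.dom.assoc)
  also have "\<dots> = \<beta> \<cdot>\<^bsub>C\<^esub> FA R (FA L (h \<cdot>\<^bsub>C\<^esub> j))"
    using a j by simp
  also have "\<dots> = (\<beta> \<cdot>\<^bsub>C\<^esub> FA R (FA L h)) \<cdot>\<^bsub>C\<^esub> FA R (FA L j)"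
    using a h(1,2) h' j(1-3) by (simp add: L.map_comp_arr R.map_comp_arr L.dom.assoc)
  also have "\<dots> = h \<cdot>\<^bsub>C\<^esub> (\<alpha> \<cdot>\<^bsub>C\<^esub> FA R (FA L j))"
    using a h h' j(1-3) by (simp add: L.dom.assoc flip: h(3))
  finally have "j \<cdot>\<^bsub>C\<^esub> \<beta> = \<alpha> \<cdot>\<^bsub>C\<^esub> FA R (FA L j)"
    by (rule L.dom.iso_cancel_left [OF i, rotated -1]) (use a h h' j in auto)
  then show ?thesis
    using a h h' j by (intro EM.isoI [where j = "((y, \<beta>), j, (x, \<alpha>))"]) simp_all
qed

end

section \<open>Coreflections\<close>

text \<open>A full embedding \<open>I\<close> with right adjoint \<open>K\<close>, presented by the counit \<open>\<delta> : I K \<rightarrow> id\<close> alone: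
  the unit is the identity, as \<open>K\<close> is a strict left inverse of \<open>I\<close>, and the last two
  assumptions are the triangle laws. Strictness holds in the intended example, where \<open>I\<close> sends an
  object to the discrete object over it.\<close>

locale coreflection = I: is_functor C0 C I + K: is_functor C C0 K
  for C0 :: "('o, 'a) cat" and C :: "('p, 'b) cat"
    and I :: "('o, 'a, 'p, 'b) fctr" and K :: "('p, 'b, 'o, 'a) fctr" +
  fixes \<delta> :: "'p \<Rightarrow> 'b"
  assumes K_I_obj [simp]: "x \<in> Obj C0 \<Longrightarrow> FO K (FO I x) = x"
    and K_I_arr [simp]: "f \<in> Arr C0 \<Longrightarrow> FA K (FA I f) = f"
    and counit: "nat_trans C C (I \<bullet> K) id_functor \<delta>"
    and K_counit [simp]: "y \<in> Obj C \<Longrightarrow> FA K (\<delta> y) = Ide C0 (FO K y)"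
    and counit_I [simp]: "x \<in> Obj C0 \<Longrightarrow> \<delta> (FO I x) = Ide C (FO I x)"
begin

text \<open>The objects isomorphic to one in the image of \<open>I\<close>.\<close>

definition discrete :: "'p \<Rightarrow> bool" where
  "discrete x \<longleftrightarrow> x \<in> Obj C \<and> is_iso C (\<delta> x)"

lemma delta_simps [simp]:
  assumes "x \<in> Obj C"
  shows "\<delta> x \<in> Arr C" and "Dom C (\<delta> x) = FO I (FO K x)" and "Cod C (\<delta> x) = x"
  using counit assms by (auto simp: nat_trans_def Hom_def)

lemma delta_natural:
  "f \<in> Arr C \<Longrightarrow> \<delta> (Cod C f) \<cdot>\<^bsub>C\<^esub> FA I (FA K f) = f \<cdot>\<^bsub>C\<^esub> \<delta> (Dom C f)"
  using counit by (auto simp: nat_trans_def)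

lemma arr_to_I:
  assumes "f \<in> Arr C" and "Cod C f = FO I z" and "z \<in> Obj C0" and "Dom C f = x"
  shows "f \<cdot>\<^bsub>C\<^esub> \<delta> x = FA I (FA K f)"
  using delta_natural [of f] assms by simp

lemma discrete_I [simp]: "z \<in> Obj C0 \<Longrightarrow> discrete (FO I z)"
  by (simp add: discrete_def I.cod.iso_ide)

text \<open>On arrows out of a discrete object \<open>K\<close> is faithful and full. This is how equations and
  arrows are moved between the two categories.\<close>

lemma discrete_arr_eq:
  assumes "f \<in> Arr C" and "g \<in> Arr C" and "Dom C f = Dom C g" and "Cod C f = Cod C g"
    and d: "discrete (Dom C g)" and eq: "FA K f = FA K g"
  shows "f = g"
proof (rule I.cod.iso_cancel_right)
  show "is_iso C (\<delta> (Dom C g))"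
    using d by (simp add: discrete_def)
  show "f \<cdot>\<^bsub>C\<^esub> \<delta> (Dom C g) = g \<cdot>\<^bsub>C\<^esub> \<delta> (Dom C g)"
    using assms delta_natural [of f] delta_natural [of g] by simp
qed (use assms in auto)

lemma discrete_lift:
  assumes d: "discrete x" and y: "y \<in> Obj C"
    and k: "k \<in> Arr C0" "Dom C0 k = FO K x" "Cod C0 k = FO K y"
  obtains f where "f \<in> Arr C" and "Dom C f = x" and "Cod C f = y" and "FA K f = k"
proof -
  have x: "x \<in> Obj C" and i: "is_iso C (\<delta> x)"
    using d by (auto simp: discrete_def)
  obtain e where e: "e \<in> Arr C" "Dom C e = Cod C (\<delta> x)" "Cod C e = Dom C (\<delta> x)"
    "\<delta> x \<cdot>\<^bsub>C\<^esub> e = Ide C (Cod C (\<delta> x))"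
    by (rule I.cod.iso_inverse [OF i])
  have "FA K (\<delta> x \<cdot>\<^bsub>C\<^esub> e) = Ide C0 (FO K x)"
    using x e by simp
  then have "FA K e = Ide C0 (FO K x)"
    using x e(1-3) by (simp add: K.map_comp_arr)
  then show ?thesis
    using x y k e by (intro that [of "\<delta> y \<cdot>\<^bsub>C\<^esub> (FA I k \<cdot>\<^bsub>C\<^esub> e)"]) (simp_all add: K.map_comp_arr)
qed

end

section \<open>Restricting a monadic adjunction to coreflective subcategories\<close>

text \<open>The left adjoint \<open>L\<close> restricts to \<open>L0\<close> strictly and commutes with the coreflections. The
  right adjoint is related to the subcategories by the last assumption only, since no choice of
  \<open>R\<close> need commute with the embeddings on the nose.\<close>

locale restricted_adjunction =
  CC: coreflection C0 C IC KC dC + DD: coreflection D0 D ID KD dD +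
  adjoint_pair C D L R \<eta> \<epsilon> + L0: is_functor C0 D0 L0
  for C0 :: "('o, 'a) cat" and C :: "('p, 'b) cat"
    and IC :: "('o, 'a, 'p, 'b) fctr" and KC :: "('p, 'b, 'o, 'a) fctr" and dC :: "'p \<Rightarrow> 'b"
    and D0 :: "('q, 'c) cat" and D :: "('r, 'd) cat"
    and ID :: "('q, 'c, 'r, 'd) fctr" and KD :: "('r, 'd, 'q, 'c) fctr" and dD :: "'r \<Rightarrow> 'd"
    and L :: "('p, 'b, 'r, 'd) fctr" and R :: "('r, 'd, 'p, 'b) fctr"
    and \<eta> :: "'p \<Rightarrow> 'b" and \<epsilon> :: "'r \<Rightarrow> 'd"
    and L0 :: "('o, 'a, 'q, 'c) fctr" +
  assumes L_I_obj [simp]: "x \<in> Obj C0 \<Longrightarrow> FO L (FO IC x) = FO ID (FO L0 x)"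
    and L_I_arr [simp]: "f \<in> Arr C0 \<Longrightarrow> FA L (FA IC f) = FA ID (FA L0 f)"
    and K_L_obj [simp]: "y \<in> Obj C \<Longrightarrow> FO KD (FO L y) = FO L0 (FO KC y)"
    and K_L_arr [simp]: "g \<in> Arr C \<Longrightarrow> FA KD (FA L g) = FA L0 (FA KC g)"
    and L_delta [simp]: "y \<in> Obj C \<Longrightarrow> FA L (dC y) = dD (FO L y)"
    and R_discrete: "DD.discrete z \<Longrightarrow> CC.discrete (FO R z)"
begin

abbreviation R0 where "R0 \<equiv> KC \<bullet> (R \<bullet> ID)"
abbreviation \<eta>0 where "\<eta>0 \<equiv> (\<lambda>x. FA KC (\<eta> (FO IC x)))"
abbreviation \<epsilon>0 where "\<epsilon>0 \<equiv> (\<lambda>y. FA KD (\<epsilon> (FO ID y)))"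

text \<open>The composite \<open>R (I (K (\<epsilon> y))) \<cdot> \<eta>\<close> is the canonical arrow \<open>I K R y \<rightarrow> R I K y\<close>, adjunct to
  \<open>I K \<epsilon>\<close>. That it factors \<open>\<delta>\<close> at \<open>R y\<close> through \<open>R \<delta>\<close> gives a triangle law of the restricted
  adjunction (when \<open>y\<close> lies in the image of \<open>I\<close>) and one half of \<open>K_R_delta_iso\<close>.\<close>

lemma mate_of_counit:
  assumes y: "y \<in> Obj D"
  shows "FA R (dD y) \<cdot>\<^bsub>C\<^esub> (FA R (FA ID (FA KD (\<epsilon> y))) \<cdot>\<^bsub>C\<^esub> \<eta> (FO IC (FO KC (FO R y)))) = dC (FO R y)"
proof -
  have "FA R (dD y) \<cdot>\<^bsub>C\<^esub> (FA R (FA ID (FA KD (\<epsilon> y))) \<cdot>\<^bsub>C\<^esub> \<eta> (FO IC (FO KC (FO R y)))) =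
      FA R (dD y \<cdot>\<^bsub>D\<^esub> FA ID (FA KD (\<epsilon> y))) \<cdot>\<^bsub>C\<^esub> \<eta> (FO IC (FO KC (FO R y)))"
    using y by (simp add: R.map_comp_arr CC.I.cod.assoc)
  also have "dD y \<cdot>\<^bsub>D\<^esub> FA ID (FA KD (\<epsilon> y)) = \<epsilon> y \<cdot>\<^bsub>D\<^esub> FA L (dC (FO R y))"
    using y DD.delta_natural [of "\<epsilon> y"] by simp
  also have "FA R \<dots> \<cdot>\<^bsub>C\<^esub> \<eta> (FO IC (FO KC (FO R y))) =
      FA R (\<epsilon> y) \<cdot>\<^bsub>C\<^esub> (FA R (FA L (dC (FO R y))) \<cdot>\<^bsub>C\<^esub> \<eta> (FO IC (FO KC (FO R y))))"
    using y by (simp add: R.map_comp_arr CC.I.cod.assoc del: L_delta)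
  also have "\<dots> = FA R (\<epsilon> y) \<cdot>\<^bsub>C\<^esub> (\<eta> (FO R y) \<cdot>\<^bsub>C\<^esub> dC (FO R y))"
    using y unit_natural [of "dC (FO R y)"] by (simp del: L_delta)
  also have "\<dots> = (FA R (\<epsilon> y) \<cdot>\<^bsub>C\<^esub> \<eta> (FO R y)) \<cdot>\<^bsub>C\<^esub> dC (FO R y)"
    using y by (simp only: CC.I.cod.assoc unit_simps counit_simps CC.delta_simps R.map_simps L.map_simps)
  also have "\<dots> = dC (FO R y)"
    using y by simp
  finally show ?thesis .
qed

text \<open>The restricted counit is the old one precomposed with \<open>L \<delta>\<close>. As \<open>K R L \<delta>\<close> is invertible,
  the algebra laws of the two monads can be translated into each other by cancelling it.\<close>

lemma counit_I_eq:
  assumes z: "z \<in> Obj D0"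
  shows "\<epsilon> (FO ID z) \<cdot>\<^bsub>D\<^esub> FA L (dC (FO R (FO ID z))) = FA ID (FA KD (\<epsilon> (FO ID z)))"
  using z DD.arr_to_I [of "\<epsilon> (FO ID z)" z] by simp

text \<open>All laws except the second triangle law are images under \<open>K\<close> of the corresponding laws for
  \<open>L\<close> and \<open>R\<close>.\<close>

lemma restricted_adjunction: "adjunction C0 D0 L0 R0 \<eta>0 \<epsilon>0"
  unfolding adjunction_def
proof (intro conjI ballI)
  show "is_functor C0 D0 L0" by (rule L0.is_functor_axioms)
  show "is_functor D0 C0 R0"
    by (intro is_functor_comp [of _ C] is_functor_comp [of _ D] CC.K.is_functor_axioms
        R.is_functor_axioms DD.I.is_functor_axioms)
next
  have "FA KC (\<eta> (FO IC (Cod C0 f))) \<cdot>\<^bsub>C0\<^esub> f =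
      FA KC (FA R (FA ID (FA L0 f))) \<cdot>\<^bsub>C0\<^esub> FA KC (\<eta> (FO IC (Dom C0 f)))" if f: "f \<in> Arr C0" for f
  proof -
    have "FA KC (\<eta> (FO IC (Cod C0 f)) \<cdot>\<^bsub>C\<^esub> FA IC f) =
        FA KC (FA R (FA L (FA IC f)) \<cdot>\<^bsub>C\<^esub> \<eta> (FO IC (Dom C0 f)))"
      using f unit_natural [of "FA IC f"] by simp
    then show ?thesis
      using f by (simp add: CC.K.map_comp_arr)
  qed
  then show "nat_trans C0 C0 id_functor (R0 \<bullet> L0) \<eta>0"
    by (simp add: nat_trans_def Hom_def)
next
  have "FA KD (\<epsilon> (FO ID (Cod D0 g))) \<cdot>\<^bsub>D0\<^esub> FA L0 (FA KC (FA R (FA ID g))) =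
      g \<cdot>\<^bsub>D0\<^esub> FA KD (\<epsilon> (FO ID (Dom D0 g)))" if g: "g \<in> Arr D0" for g
  proof -
    have "FA KD (\<epsilon> (FO ID (Cod D0 g)) \<cdot>\<^bsub>D\<^esub> FA L (FA R (FA ID g))) =
        FA KD (FA ID g \<cdot>\<^bsub>D\<^esub> \<epsilon> (FO ID (Dom D0 g)))"
      using g counit_natural [of "FA ID g"] by simp
    then show ?thesis
      using g by (simp add: DD.K.map_comp_arr)
  qed
  then show "nat_trans D0 D0 (L0 \<bullet> R0) id_functor \<epsilon>0"
    by (simp add: nat_trans_def Hom_def)
next
  fix x assume x: "x \<in> Obj C0"
  have "FA KD (\<epsilon> (FO L (FO IC x)) \<cdot>\<^bsub>D\<^esub> FA L (\<eta> (FO IC x))) = Ide D0 (FO L0 x)"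
    using x triangle_left [of "FO IC x"] by simp
  then show "\<epsilon>0 (FO L0 x) \<cdot>\<^bsub>D0\<^esub> FA L0 (\<eta>0 x) = Ide D0 (FO L0 x)"
    using x by (simp add: DD.K.map_comp_arr)
next
  fix y assume y: "y \<in> Obj D0"
  have "FA KC (FA R (FA ID (FA KD (\<epsilon> (FO ID y)))) \<cdot>\<^bsub>C\<^esub> \<eta> (FO IC (FO KC (FO R (FO ID y))))) =
      Ide C0 (FO KC (FO R (FO ID y)))"
    using y mate_of_counit [of "FO ID y"] by simp
  then show "FA R0 (\<epsilon>0 y) \<cdot>\<^bsub>C0\<^esub> \<eta>0 (FO R0 y) = Ide C0 (FO R0 y)"
    using y by (simp add: CC.K.map_comp_arr)
qed

sublocale A0: adjoint_pair C0 D0 L0 R0 \<eta>0 \<epsilon>0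
  by unfold_locales (rule restricted_adjunction)

text \<open>Both \<open>K R\<close> and \<open>(K R I) K\<close> are right adjoint to \<open>L I = I L0\<close>, and \<open>K R \<delta>\<close> is the canonical
  arrow between them. Its inverse is the image under \<open>K\<close> of the arrow of \<open>mate_of_counit\<close>. For
  general \<open>y\<close> the arrow \<open>R (\<delta> y)\<close> itself is not invertible.\<close>

lemma K_R_delta_iso:
  assumes y: "y \<in> Obj D"
  shows "is_iso C0 (FA KC (FA R (dD y)))"
proof -
  define \<theta> where "\<theta> = (\<lambda>y. FA R (FA ID (FA KD (\<epsilon> y))) \<cdot>\<^bsub>C\<^esub> \<eta> (FO IC (FO KC (FO R y))))"
  have \<theta>: "\<theta> y \<in> Arr C" "Dom C (\<theta> y) = FO IC (FO KC (FO R y))"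
    "Cod C (\<theta> y) = FO R (FO ID (FO KD y))"
    "FA R (dD y) \<cdot>\<^bsub>C\<^esub> \<theta> y = dC (FO R y)" if "y \<in> Obj D" for y
    using that mate_of_counit [OF that] by (simp_all add: \<theta>_def)
  \<comment> \<open>The other composite: sliding \<open>I K R \<delta>\<close> through \<open>\<eta>\<close> and \<open>\<epsilon>\<close> turns the mate at \<open>y\<close> into the
    mate at \<open>I K y\<close>, which is \<open>\<delta>\<close> and so an identity after \<open>K\<close>.\<close>
  let ?w = "FO ID (FO KD y)" and ?g = "FA IC (FA KC (FA R (dD y)))"
  have "FA KD (\<epsilon> y) \<cdot>\<^bsub>D0\<^esub> FA L0 (FA KC (FA R (dD y))) = FA KD (\<epsilon> y \<cdot>\<^bsub>D\<^esub> FA L (FA R (dD y)))"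
    using y by (simp add: DD.K.map_comp_arr)
  also have "\<dots> = FA KD (dD y \<cdot>\<^bsub>D\<^esub> \<epsilon> ?w)"
    using y counit_natural [of "dD y"] by simp
  also have "\<dots> = FA KD (\<epsilon> ?w)"
    using y by (simp add: DD.K.map_comp_arr)
  finally have e: "FA KD (\<epsilon> y) \<cdot>\<^bsub>D0\<^esub> FA L0 (FA KC (FA R (dD y))) = FA KD (\<epsilon> ?w)" .
  have "\<theta> y \<cdot>\<^bsub>C\<^esub> ?g = FA R (FA ID (FA KD (\<epsilon> y))) \<cdot>\<^bsub>C\<^esub> (\<eta> (FO IC (FO KC (FO R y))) \<cdot>\<^bsub>C\<^esub> ?g)"
    using y by (simp add: \<theta>_def CC.I.cod.assoc)
  also have "\<dots> = FA R (FA ID (FA KD (\<epsilon> y))) \<cdot>\<^bsub>C\<^esub>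
      (FA R (FA L ?g) \<cdot>\<^bsub>C\<^esub> \<eta> (FO IC (FO KC (FO R ?w))))"
    using y unit_natural [of ?g] by simp
  also have "\<dots> = FA R (FA ID (FA KD (\<epsilon> y) \<cdot>\<^bsub>D0\<^esub> FA L0 (FA KC (FA R (dD y))))) \<cdot>\<^bsub>C\<^esub>
      \<eta> (FO IC (FO KC (FO R ?w)))"
    using y by (simp add: R.map_comp_arr DD.I.map_comp_arr CC.I.cod.assoc)
  also have "\<dots> = \<theta> ?w"
    by (simp add: e \<theta>_def)
  also have "\<dots> = dC (FO R ?w)"
    using y \<theta>(1-3) [of ?w] \<theta>(4) [of ?w] by simp
  finally have "FA KC (\<theta> y \<cdot>\<^bsub>C\<^esub> ?g) = Ide C0 (FO KC (FO R ?w))"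
    using y by simp
  then have "FA KC (\<theta> y) \<cdot>\<^bsub>C0\<^esub> FA KC (FA R (dD y)) = Ide C0 (FO KC (FO R ?w))"
    using y by (simp add: CC.K.map_comp_arr \<theta>)
  moreover have "FA KC (FA R (dD y) \<cdot>\<^bsub>C\<^esub> \<theta> y) = Ide C0 (FO KC (FO R y))"
    using y by (simp add: \<theta>)
  then have "FA KC (FA R (dD y)) \<cdot>\<^bsub>C0\<^esub> FA KC (\<theta> y) = Ide C0 (FO KC (FO R y))"
    using y by (simp add: CC.K.map_comp_arr \<theta>(1-3))
  ultimately show ?thesis
    using y by (intro CC.I.dom.isoI [where j = "FA KC (\<theta> y)"]) (simp_all add: \<theta>(1-3))
qed

lemma K_R_L_delta_iso: "y \<in> Obj C \<Longrightarrow> is_iso C0 (FA KC (FA R (dD (FO L y))))"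
  by (rule K_R_delta_iso) simp

lemma L_discrete: "CC.discrete x \<Longrightarrow> DD.discrete (FO L x)"
  using L.map_iso [of "dC x"] by (simp add: CC.discrete_def DD.discrete_def)

lemma R_L_discrete: "CC.discrete x \<Longrightarrow> CC.discrete (FO R (FO L x))"
  by (intro R_discrete L_discrete)

text \<open>The free algebra \<open>R L (I x)\<close> is discrete, so that the structure map lifts along \<open>K\<close>, and so
  are the sources of both algebra laws, which can therefore be checked after applying \<open>K\<close>. For
  associativity this leaves an equation between arrows out of \<open>K R L R L (I x)\<close>, whereas the law at
  hand is about arrows out of \<open>K R I K L R L (I x)\<close>; the isomorphism \<open>K R L \<delta>\<close> compares the two.\<close>

lemma algebra_lift:
  assumes a: "A0.algebra x \<alpha>0"
  obtains \<alpha> where "algebra (FO IC x) \<alpha>" and "FA KC \<alpha> = \<alpha>0"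
proof -
  let ?Lx = "FO ID (FO L0 x)"
  let ?T = "FO R ?Lx"
  have x: "x \<in> Obj C0" and a0: "\<alpha>0 \<in> Arr C0" "Dom C0 \<alpha>0 = FO KC ?T" "Cod C0 \<alpha>0 = x"
    and unit0: "\<alpha>0 \<cdot>\<^bsub>C0\<^esub> FA KC (\<eta> (FO IC x)) = Ide C0 x"
    and mult0: "\<alpha>0 \<cdot>\<^bsub>C0\<^esub> FA KC (FA R (FA ID (FA KD (\<epsilon> ?Lx)))) =
      \<alpha>0 \<cdot>\<^bsub>C0\<^esub> FA KC (FA R (FA ID (FA L0 \<alpha>0)))"
    using a [unfolded A0.algebra_def] by simp_all
  have dT: "CC.discrete ?T"
    using x by (intro R_discrete) simp
  obtain \<alpha> where al: "\<alpha> \<in> Arr C" "Dom C \<alpha> = ?T" "Cod C \<alpha> = FO IC x" "FA KC \<alpha> = \<alpha>0"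
    by (rule CC.discrete_lift [OF dT, of "FO IC x" \<alpha>0]) (use x a0 in auto)
  have \<alpha>_delta: "\<alpha> \<cdot>\<^bsub>C\<^esub> dC ?T = FA IC \<alpha>0"
    using CC.arr_to_I [OF al(1) al(3) x al(2)] al(4) by simp
  have "\<alpha> \<cdot>\<^bsub>C\<^esub> \<eta> (FO IC x) = Ide C (FO IC x)"
    by (rule CC.discrete_arr_eq) (use x al unit0 in \<open>simp_all add: CC.K.map_comp_arr\<close>)
  moreover have "\<alpha> \<cdot>\<^bsub>C\<^esub> FA R (\<epsilon> ?Lx) = \<alpha> \<cdot>\<^bsub>C\<^esub> FA R (FA L \<alpha>)"
  proof (rule CC.discrete_arr_eq)
    let ?d = "FA KC (FA R (FA L (dC ?T)))"
    have d_iso: "is_iso C0 ?d"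
      using x K_R_L_delta_iso [of ?T] by simp
    have "FA KC (\<alpha> \<cdot>\<^bsub>C\<^esub> FA R (\<epsilon> ?Lx)) \<cdot>\<^bsub>C0\<^esub> ?d =
        FA KC (\<alpha> \<cdot>\<^bsub>C\<^esub> FA R (FA L \<alpha>)) \<cdot>\<^bsub>C0\<^esub> ?d"
    proof -
      have "FA KC (\<alpha> \<cdot>\<^bsub>C\<^esub> FA R (\<epsilon> ?Lx)) \<cdot>\<^bsub>C0\<^esub> ?d =
          \<alpha>0 \<cdot>\<^bsub>C0\<^esub> FA KC (FA R (\<epsilon> ?Lx \<cdot>\<^bsub>D\<^esub> FA L (dC ?T)))"
        using x al a0 by (simp add: CC.K.map_comp_arr R.map_comp_arr CC.I.dom.assoc del: L_delta)
      also have "\<dots> = \<alpha>0 \<cdot>\<^bsub>C0\<^esub> FA KC (FA R (FA ID (FA L0 \<alpha>0)))"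
        using x mult0 by (simp only: counit_I_eq L0.map_simps)
      also have "\<dots> = \<alpha>0 \<cdot>\<^bsub>C0\<^esub> FA KC (FA R (FA L (\<alpha> \<cdot>\<^bsub>C\<^esub> dC ?T)))"
        using a0 by (simp add: \<alpha>_delta)
      also have "\<dots> = FA KC (\<alpha> \<cdot>\<^bsub>C\<^esub> FA R (FA L \<alpha>)) \<cdot>\<^bsub>C0\<^esub> ?d"
        using x al a0 by (simp add: CC.K.map_comp_arr R.map_comp_arr L.map_comp_arr CC.I.dom.assoc del: L_delta)
      finally show ?thesis .
    qed
    then show "FA KC (\<alpha> \<cdot>\<^bsub>C\<^esub> FA R (\<epsilon> ?Lx)) = FA KC (\<alpha> \<cdot>\<^bsub>C\<^esub> FA R (FA L \<alpha>))"
      by (rule CC.I.dom.iso_cancel_right [OF d_iso, rotated -1]) (use x al in simp_all)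
    show "CC.discrete (Dom C (\<alpha> \<cdot>\<^bsub>C\<^esub> FA R (FA L \<alpha>)))"
      using x al dT R_L_discrete by simp
  qed (use x al in simp_all)
  ultimately have "algebra (FO IC x) \<alpha>"
    using x al unfolding algebra_def by simp
  with al(4) show ?thesis by (rule that [rotated])
qed

text \<open>Lift the algebra and let \<open>y\<close> be an object whose comparison algebra is isomorphic to the lift
  by \<open>h\<close>. Then \<open>K y\<close> solves the problem in the subcategory: \<open>k = K (h \<cdot> R \<delta>)\<close> is invertible by
  \<open>K_R_delta_iso\<close>, and it is an algebra morphism because, after the restricted counit has been
  rewritten by \<open>counit_I_eq\<close>, naturality of \<open>\<epsilon>\<close> at \<open>\<delta>\<close> reduces the claim to \<open>h\<close> being one.\<close>

lemma restricted_essentially_surjective: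
  assumes es: "essentially_surjective D EM (comparison D R \<epsilon>)"
  shows "essentially_surjective D0 A0.EM (comparison D0 R0 \<epsilon>0)"
  unfolding essentially_surjective_def
proof
  fix X assume "X \<in> Obj A0.EM"
  then obtain x \<alpha>0 where X: "X = (x, \<alpha>0)" and a: "A0.algebra x \<alpha>0"
    by (cases X) auto
  obtain \<alpha> where al: "algebra (FO IC x) \<alpha>" and K_\<alpha>: "FA KC \<alpha> = \<alpha>0"
    by (rule algebra_lift [OF a])
  have x: "x \<in> Obj C0"
    using a by simp
  from es al obtain y i where y: "y \<in> Obj D" and i: "is_iso EM i"
    "i \<in> Hom EM (FO R y, FA R (\<epsilon> y)) (FO IC x, \<alpha>)"
    unfolding essentially_surjective_def by force
  then obtain h where h: "h \<in> Arr C" "Dom C h = FO R y" "Cod C h = FO IC x"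
      "h \<cdot>\<^bsub>C\<^esub> FA R (\<epsilon> y) = \<alpha> \<cdot>\<^bsub>C\<^esub> FA R (FA L h)"
    and i_eq: "i = ((FO R y, FA R (\<epsilon> y)), h, (FO IC x, \<alpha>))"
    by (cases i) (auto simp: Hom_def)
  have h_iso: "is_iso C h"
    using i(1) h unfolding i_eq is_iso_def by (auto simp: Hom_def)
  let ?w = "FO KD y"
  let ?d = "FA R (dD y)"
  let ?e = "dC (FO R (FO ID ?w))"
  define k where "k = FA KC (h \<cdot>\<^bsub>C\<^esub> ?d)"
  have k: "k \<in> Arr C0" "Dom C0 k = FO KC (FO R (FO ID ?w))" "Cod C0 k = x"
    using x y h by (simp_all add: k_def)
  have k_iso: "is_iso C0 k"
    using y h CC.K.map_iso [OF h_iso] K_R_delta_iso [OF y]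
    by (auto simp: k_def CC.K.map_comp_arr intro: CC.I.dom.iso_comp)
  have "k \<cdot>\<^bsub>C0\<^esub> FA R0 (\<epsilon>0 ?w) = FA KC (h \<cdot>\<^bsub>C\<^esub> FA R (dD y \<cdot>\<^bsub>D\<^esub> FA ID (FA KD (\<epsilon> (FO ID ?w)))))"
    using y h by (simp add: k_def CC.K.map_comp_arr R.map_comp_arr CC.I.dom.assoc)
  also have "dD y \<cdot>\<^bsub>D\<^esub> FA ID (FA KD (\<epsilon> (FO ID ?w))) =
      dD y \<cdot>\<^bsub>D\<^esub> (\<epsilon> (FO ID ?w) \<cdot>\<^bsub>D\<^esub> FA L ?e)"
    using y by (simp add: counit_I_eq del: L_delta)
  also have "\<dots> = (dD y \<cdot>\<^bsub>D\<^esub> \<epsilon> (FO ID ?w)) \<cdot>\<^bsub>D\<^esub> FA L ?e"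
    using y by (simp add: DD.I.cod.assoc)
  also have "\<dots> = (\<epsilon> y \<cdot>\<^bsub>D\<^esub> FA L ?d) \<cdot>\<^bsub>D\<^esub> FA L ?e"
    using y counit_natural [of "dD y"] by simp
  also have "\<dots> = \<epsilon> y \<cdot>\<^bsub>D\<^esub> FA L (?d \<cdot>\<^bsub>C\<^esub> ?e)"
    using y by (simp add: DD.I.cod.assoc L.map_comp_arr)
  also have "FA KC (h \<cdot>\<^bsub>C\<^esub> FA R \<dots>) =
      FA KC ((h \<cdot>\<^bsub>C\<^esub> FA R (\<epsilon> y)) \<cdot>\<^bsub>C\<^esub> FA R (FA L (?d \<cdot>\<^bsub>C\<^esub> ?e)))"
    using y h(1-3) by (simp add: R.map_comp_arr CC.I.cod.assoc)
  also have "\<dots> = FA KC (\<alpha> \<cdot>\<^bsub>C\<^esub> FA R (FA L ((h \<cdot>\<^bsub>C\<^esub> ?d) \<cdot>\<^bsub>C\<^esub> ?e)))"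
    using y h al by (simp add: R.map_comp_arr L.map_comp_arr CC.I.cod.assoc del: L_delta)
  also have "(h \<cdot>\<^bsub>C\<^esub> ?d) \<cdot>\<^bsub>C\<^esub> ?e = FA IC k"
    unfolding k_def by (rule CC.arr_to_I) (use x y h in simp_all)
  also have "FA KC (\<alpha> \<cdot>\<^bsub>C\<^esub> FA R (FA L (FA IC k))) = \<alpha>0 \<cdot>\<^bsub>C0\<^esub> FA R0 (FA L0 k)"
    using x k al K_\<alpha> by (simp add: CC.K.map_comp_arr)
  finally have "k \<cdot>\<^bsub>C0\<^esub> FA R0 (\<epsilon>0 ?w) = \<alpha>0 \<cdot>\<^bsub>C0\<^esub> FA R0 (FA L0 k)" .
  moreover have "A0.algebra (FO R0 ?w) (FA R0 (\<epsilon>0 ?w))"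
    using y by (intro A0.algebra_counit) simp
  ultimately have "is_iso A0.EM ((FO R0 ?w, FA R0 (\<epsilon>0 ?w)), k, (x, \<alpha>0))"
    by (intro A0.algebra_iso a k_iso) (use k in simp_all)
  moreover from this have "((FO R0 ?w, FA R0 (\<epsilon>0 ?w)), k, (x, \<alpha>0)) \<in>
      Hom A0.EM (FO (comparison D0 R0 \<epsilon>0) ?w) X"
    unfolding is_iso_def Hom_def by (auto simp: X)
  ultimately show "\<exists>w \<in> Obj D0. \<exists>i \<in> Hom A0.EM (FO (comparison D0 R0 \<epsilon>0) w) X. is_iso A0.EM i"
    using y by (intro bexI [of _ ?w]) auto
qed

text \<open>As \<open>R (I y)\<close> is discrete, arrows out of it are determined by, and can be lifted from, their
  images under \<open>K\<close>. The lift of an algebra morphism is again one: as in \<open>algebra_lift\<close>, both sides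
  agree after applying \<open>K\<close> and cancelling \<open>K R L \<delta>\<close>.\<close>

lemma restricted_fully_faithful:
  assumes ff: "fully_faithful D EM (comparison D R \<epsilon>)"
  shows "fully_faithful D0 A0.EM (comparison D0 R0 \<epsilon>0)"
  unfolding fully_faithful_def bij_betw_def
proof (intro ballI conjI)
  interpret Phi: is_functor D EM "comparison D R \<epsilon>" by (rule comparison_functor)
  interpret Phi0: is_functor D0 A0.EM "comparison D0 R0 \<epsilon>0" by (rule A0.comparison_functor)
  fix y z assume y: "y \<in> Obj D0" and z: "z \<in> Obj D0"
  let ?Ry = "FO R (FO ID y)" and ?Rz = "FO R (FO ID z)"
  have dy: "CC.discrete ?Ry"
    using y by (intro R_discrete) simp
  show "inj_on (FA (comparison D0 R0 \<epsilon>0)) (Hom D0 y z)"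
  proof (rule inj_onI)
    fix f g assume f: "f \<in> Hom D0 y z" and g: "g \<in> Hom D0 y z"
      and eq: "FA (comparison D0 R0 \<epsilon>0) f = FA (comparison D0 R0 \<epsilon>0) g"
    have a: "f \<in> Arr D0" "Dom D0 f = y" "Cod D0 f = z" "g \<in> Arr D0" "Dom D0 g = y" "Cod D0 g = z"
      using f g by (auto simp: Hom_def)
    have "FA R (FA ID f) = FA R (FA ID g)"
      by (rule CC.discrete_arr_eq) (use a dy eq in simp_all)
    then have "FA ID f = FA ID g"
      by (intro Phi.fully_faithful_arr_eq [OF ff]) (use a in simp_all)
    then have "FA KD (FA ID f) = FA KD (FA ID g)" by simp
    then show "f = g"
      using a by simp
  qed
  show "FA (comparison D0 R0 \<epsilon>0) ` Hom D0 y z =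
      Hom A0.EM (FO (comparison D0 R0 \<epsilon>0) y) (FO (comparison D0 R0 \<epsilon>0) z)"
  proof (intro equalityI subsetI)
    fix K assume "K \<in> FA (comparison D0 R0 \<epsilon>0) ` Hom D0 y z"
    then show "K \<in> Hom A0.EM (FO (comparison D0 R0 \<epsilon>0) y) (FO (comparison D0 R0 \<epsilon>0) z)"
      using Phi0.map_hom by blast
  next
    fix K assume "K \<in> Hom A0.EM (FO (comparison D0 R0 \<epsilon>0) y) (FO (comparison D0 R0 \<epsilon>0) z)"
    then obtain k where K: "K = (FO (comparison D0 R0 \<epsilon>0) y, k, FO (comparison D0 R0 \<epsilon>0) z)"
      and k: "k \<in> Arr C0" "Dom C0 k = FO KC ?Ry" "Cod C0 k = FO KC ?Rz"
      and hom: "k \<cdot>\<^bsub>C0\<^esub> FA KC (FA R (FA ID (FA KD (\<epsilon> (FO ID y))))) =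
        FA KC (FA R (FA ID (FA KD (\<epsilon> (FO ID z))))) \<cdot>\<^bsub>C0\<^esub> FA KC (FA R (FA ID (FA L0 k)))"
      by (cases K) (auto simp: Hom_def)
    obtain k' where k': "k' \<in> Arr C" "Dom C k' = ?Ry" "Cod C k' = ?Rz" "FA KC k' = k"
      by (rule CC.discrete_lift [OF dy, of ?Rz k]) (use z k in auto)
    have "k' \<cdot>\<^bsub>C\<^esub> FA R (\<epsilon> (FO ID y)) = FA R (\<epsilon> (FO ID z)) \<cdot>\<^bsub>C\<^esub> FA R (FA L k')"
    proof (rule CC.discrete_arr_eq)
      let ?d = "FA KC (FA R (FA L (dC ?Ry)))"
      have d_iso: "is_iso C0 ?d"
        using y K_R_L_delta_iso [of ?Ry] by simp
      have "FA KC (k' \<cdot>\<^bsub>C\<^esub> FA R (\<epsilon> (FO ID y))) \<cdot>\<^bsub>C0\<^esub> ?d =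
          FA KC (FA R (\<epsilon> (FO ID z)) \<cdot>\<^bsub>C\<^esub> FA R (FA L k')) \<cdot>\<^bsub>C0\<^esub> ?d"
      proof -
        have "FA KC (k' \<cdot>\<^bsub>C\<^esub> FA R (\<epsilon> (FO ID y))) \<cdot>\<^bsub>C0\<^esub> ?d =
            k \<cdot>\<^bsub>C0\<^esub> FA KC (FA R (\<epsilon> (FO ID y) \<cdot>\<^bsub>D\<^esub> FA L (dC ?Ry)))"
          using y k k' by (simp add: CC.K.map_comp_arr R.map_comp_arr CC.I.dom.assoc del: L_delta)
        also have "\<dots> = FA KC (FA R (FA ID (FA KD (\<epsilon> (FO ID z))))) \<cdot>\<^bsub>C0\<^esub>
            FA KC (FA R (FA ID (FA L0 k)))"
          using y by (simp only: counit_I_eq hom)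
        also have "\<dots> = FA KC (FA R (\<epsilon> (FO ID z) \<cdot>\<^bsub>D\<^esub> FA L (dC ?Rz))) \<cdot>\<^bsub>C0\<^esub>
            FA KC (FA R (FA L (FA IC k)))"
          using z k by (simp only: counit_I_eq L_I_arr)
        also have "\<dots> = FA KC (FA R (\<epsilon> (FO ID z)) \<cdot>\<^bsub>C\<^esub> FA R (FA L (dC ?Rz \<cdot>\<^bsub>C\<^esub> FA IC k)))"
          using z k
          by (simp add: CC.K.map_comp_arr R.map_comp_arr L.map_comp_arr CC.I.dom.assoc del: L_delta L_I_arr)
        also have "dC ?Rz \<cdot>\<^bsub>C\<^esub> FA IC k = k' \<cdot>\<^bsub>C\<^esub> dC ?Ry"
          using CC.delta_natural [of k'] k' by simp
        also have "FA KC (FA R (\<epsilon> (FO ID z)) \<cdot>\<^bsub>C\<^esub> FA R (FA L \<dots>)) =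
            FA KC (FA R (\<epsilon> (FO ID z)) \<cdot>\<^bsub>C\<^esub> FA R (FA L k')) \<cdot>\<^bsub>C0\<^esub> ?d"
          using y z k'
          by (simp add: CC.K.map_comp_arr R.map_comp_arr L.map_comp_arr CC.I.dom.assoc del: L_delta)
        finally show ?thesis .
      qed
      then show "FA KC (k' \<cdot>\<^bsub>C\<^esub> FA R (\<epsilon> (FO ID y))) =
          FA KC (FA R (\<epsilon> (FO ID z)) \<cdot>\<^bsub>C\<^esub> FA R (FA L k'))"
        by (rule CC.I.dom.iso_cancel_right [OF d_iso, rotated -1]) (use y z k' in simp_all)
      show "CC.discrete (Dom C (FA R (\<epsilon> (FO ID z)) \<cdot>\<^bsub>C\<^esub> FA R (FA L k')))"
        using z k' R_L_discrete [OF dy] by simp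
    qed (use y z k' in simp_all)
    then have Phi_k: "((?Ry, FA R (\<epsilon> (FO ID y))), k', (?Rz, FA R (\<epsilon> (FO ID z)))) \<in>
        Hom EM (FO (comparison D R \<epsilon>) (FO ID y)) (FO (comparison D R \<epsilon>) (FO ID z))"
      using y z k' by (simp add: Hom_def algebra_counit)
    obtain f where f: "f \<in> Arr D" "Dom D f = FO ID y" "Cod D f = FO ID z"
      and "FA (comparison D R \<epsilon>) f = ((?Ry, FA R (\<epsilon> (FO ID y))), k', (?Rz, FA R (\<epsilon> (FO ID z))))"
      by (rule Phi.fully_faithful_obtain [OF ff _ _ Phi_k]) (use y z in simp_all)
    then have Rf: "FA R f = k'" by simp
    have "FA ID (FA KD f) = f"
      using DD.arr_to_I [OF f(1,3) z f(2)] f y by simp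
    then have "FA (comparison D0 R0 \<epsilon>0) (FA KD f) = K"
      using f y z k' Rf by (simp add: K)
    moreover have "FA KD f \<in> Hom D0 y z"
      using f y z by (simp add: Hom_def)
    ultimately show "K \<in> FA (comparison D0 R0 \<epsilon>0) ` Hom D0 y z" by blast
  qed
qed

theorem restricted_monadic:
  assumes "monadic_adjunction C D L R \<eta> \<epsilon>"
  shows "monadic_adjunction C0 D0 L0 R0 \<eta>0 \<epsilon>0"
proof -
  interpret Phi0: is_functor D0 A0.EM "comparison D0 R0 \<epsilon>0" by (rule A0.comparison_functor)
  have "is_equivalence D EM (comparison D R \<epsilon>)"
    using assms by (simp add: monadic_adjunction_def)
  then have "is_equivalence D0 A0.EM (comparison D0 R0 \<epsilon>0)"
    by (intro Phi0.equivalenceI restricted_fully_faithful restricted_essentially_surjective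
        equivalence_fully_faithful equivalence_essentially_surjective)
  then show ?thesis
    by (simp add: monadic_adjunction_def restricted_adjunction)
qed

end

section \<open>Slices over a functor with discrete objects\<close>

lemma slice_simps [simp]:
  "f \<in> Obj (slice X b) \<longleftrightarrow> f \<in> Arr X \<and> Cod X f = b"
  "(f, h, g) \<in> Arr (slice X b) \<longleftrightarrow> f \<in> Arr X \<and> Cod X f = b \<and> g \<in> Arr X \<and> Cod X g = b \<and>
     h \<in> Arr X \<and> Dom X h = Dom X f \<and> Cod X h = Dom X g \<and> g \<cdot>\<^bsub>X\<^esub> h = f"
  "Dom (slice X b) (f, h, g) = f" "Cod (slice X b) (f, h, g) = g"
  "Ide (slice X b) f = (f, Ide X (Dom X f), f)"
  "(g', k, l) \<cdot>\<^bsub>slice X b\<^esub> (f, h, g) = (f, k \<cdot>\<^bsub>X\<^esub> h, l)"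
  by (auto simp: slice_def Hom_def)

lemma (in category) category_slice: "category (slice C b)"
proof unfold_locales
  fix f x y g z
  assume "f \<in> Hom (slice C b) x y" and "g \<in> Hom (slice C b) y z"
  then show "g \<cdot>\<^bsub>slice C b\<^esub> f \<in> Hom (slice C b) x z"
    by (cases f; cases g) (auto simp: Hom_def simp flip: assoc)
next
  fix f x y g z h w
  assume "f \<in> Hom (slice C b) w x" and "g \<in> Hom (slice C b) x y" and "h \<in> Hom (slice C b) y z"
  then show "(h \<cdot>\<^bsub>slice C b\<^esub> g) \<cdot>\<^bsub>slice C b\<^esub> f = h \<cdot>\<^bsub>slice C b\<^esub> (g \<cdot>\<^bsub>slice C b\<^esub> f)"
    by (cases f; cases g; cases h) (auto simp: Hom_def assoc)
next
  fix f assume "f \<in> Arr (slice C b)"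
  then show "Dom (slice C b) f \<in> Obj (slice C b)" "Cod (slice C b) f \<in> Obj (slice C b)"
    by (cases f; auto)+
next
  fix f x y assume "f \<in> Hom (slice C b) x y"
  then show "f \<cdot>\<^bsub>slice C b\<^esub> Ide (slice C b) x = f" "Ide (slice C b) y \<cdot>\<^bsub>slice C b\<^esub> f = f"
    by (cases f; auto simp: Hom_def)+
qed (auto simp: Hom_def)

lemma postcomp_simps [simp]:
  "FO (postcomp X p) f = p \<cdot>\<^bsub>X\<^esub> f"
  "FA (postcomp X p) (f, h, g) = (p \<cdot>\<^bsub>X\<^esub> f, h, p \<cdot>\<^bsub>X\<^esub> g)"
  by (simp_all add: postcomp_def)

lemma (in category) postcomp_functor:
  assumes p: "p \<in> Arr C"
  shows "is_functor (slice C (Dom C p)) (slice C (Cod C p)) (postcomp C p)"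
proof -
  interpret a: category "slice C (Dom C p)" by (rule category_slice)
  interpret b: category "slice C (Cod C p)" by (rule category_slice)
  show ?thesis
  proof unfold_locales
    fix f x y assume "f \<in> Hom (slice C (Dom C p)) x y"
    then show "FA (postcomp C p) f \<in>
        Hom (slice C (Cod C p)) (FO (postcomp C p) x) (FO (postcomp C p) y)"
      using p by (cases f) (auto simp: Hom_def assoc)
  next
    fix f x y g z assume "f \<in> Hom (slice C (Dom C p)) x y" "g \<in> Hom (slice C (Dom C p)) y z"
    then show "FA (postcomp C p) (g \<cdot>\<^bsub>slice C (Dom C p)\<^esub> f) =
        FA (postcomp C p) g \<cdot>\<^bsub>slice C (Cod C p)\<^esub> FA (postcomp C p) f"
      by (cases f; cases g) (auto simp: Hom_def)
  qed (use p in auto)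
qed

text \<open>A left adjoint of \<open>U\<close> on objects, with identities as unit; uniqueness in the universal
  property comes from faithfulness.\<close>

locale discrete_objects = is_functor C A U
  for C :: "('p, 'b) cat" and A :: "('o, 'a) cat" and U :: "('p, 'b, 'o, 'a) fctr" +
  fixes disc :: "'o \<Rightarrow> 'p"
  assumes faithful: "faithful C U"
    and disc_obj [simp]: "a \<in> Obj A \<Longrightarrow> disc a \<in> Obj C"
    and over_disc [simp]: "a \<in> Obj A \<Longrightarrow> FO U (disc a) = a"
    and disc_arr: "f \<in> Hom A a (FO U y) \<Longrightarrow> y \<in> Obj C \<Longrightarrow>
      \<exists>g \<in> Hom C (disc a) y. FA U g = f"
begin

definition lift :: "'a \<Rightarrow> 'p \<Rightarrow> 'b" where
  "lift f y = (SOME g. g \<in> Hom C (disc (Dom A f)) y \<and> FA U g = f)"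

lemma lift_simps [simp]:
  assumes "f \<in> Arr A" and "y \<in> Obj C" and "Cod A f = FO U y"
  shows "lift f y \<in> Arr C" and "Dom C (lift f y) = disc (Dom A f)" and "Cod C (lift f y) = y"
    and "FA U (lift f y) = f"
proof -
  have "\<exists>g. g \<in> Hom C (disc (Dom A f)) y \<and> FA U g = f"
    using disc_arr [of f "Dom A f" y] assms by (auto simp: Hom_def)
  then have "lift f y \<in> Hom C (disc (Dom A f)) y \<and> FA U (lift f y) = f"
    unfolding lift_def by (rule someI_ex)
  then show "lift f y \<in> Arr C" and "Dom C (lift f y) = disc (Dom A f)" and "Cod C (lift f y) = y"
    and "FA U (lift f y) = f"
    by (auto simp: Hom_def)
qed

lemma arr_eqI:
  assumes "f \<in> Arr C" and "g \<in> Arr C" and "Dom C f = Dom C g" and "Cod C f = Cod C g"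
    and "FA U f = FA U g"
  shows "f = g"
  using assms faithful unfolding faithful_def by blast

text \<open>This rule and the next normalize every composite that occurs in the coreflection of a slice
  to a single lift, so that the equations there reduce to equations in \<open>A\<close>.\<close>

lemma comp_lift [simp]:
  assumes "f \<in> Arr A" and "g \<in> Arr C" and "Dom C g = x" and "Cod A f = FO U x"
  shows "g \<cdot>\<^bsub>C\<^esub> lift f x = lift (FA U g \<cdot>\<^bsub>A\<^esub> f) (Cod C g)"
proof -
  have "x \<in> Obj C"
    using assms by auto
  then show ?thesis
    using assms by (intro arr_eqI) (simp_all add: map_comp_arr)
qed

lemma lift_ide [simp]: "a \<in> Obj A \<Longrightarrow> lift (Ide A a) (disc a) = Ide C (disc a)"
  by (rule arr_eqI) simp_all

text \<open>The adjunction \<open>disc \<stileturn> U\<close> induces one between the slices over \<open>FO U y\<close> and over \<open>y\<close>: the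
  left adjoint transposes \<open>c \<rightarrow> FO U y\<close> to \<open>disc c \<rightarrow> y\<close>.\<close>

definition disc_slice :: "'p \<Rightarrow> ('a, 'a \<times> 'a \<times> 'a, 'b, 'b \<times> 'b \<times> 'b) fctr" where
  "disc_slice y = \<lparr>FO = (\<lambda>f. lift f y),
     FA = (\<lambda>(f, h, g). (lift f y, lift h (disc (Dom A g)), lift g y))\<rparr>"

definition U_slice :: "('b, 'b \<times> 'b \<times> 'b, 'a, 'a \<times> 'a \<times> 'a) fctr" where
  "U_slice = \<lparr>FO = FA U, FA = (\<lambda>(f, h, g). (FA U f, FA U h, FA U g))\<rparr>"

definition slice_counit :: "'b \<Rightarrow> 'b \<times> 'b \<times> 'b" where
  "slice_counit f =
     (lift (FA U f) (Cod C f), lift (Ide A (FO U (Dom C f))) (Dom C f), f)"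

lemma slice_functor_simps [simp]:
  "FO (disc_slice y) f = lift f y"
  "FA (disc_slice y) (f, h, g) = (lift f y, lift h (disc (Dom A g)), lift g y)"
  "FO U_slice k = FA U k"
  "FA U_slice (k, l, m) = (FA U k, FA U l, FA U m)"
  by (simp_all add: disc_slice_def U_slice_def)

lemma coreflection_slice:
  assumes y: "y \<in> Obj C"
  shows "coreflection (slice A (FO U y)) (slice C y) (disc_slice y) U_slice slice_counit"
proof -
  interpret a: category "slice A (FO U y)" by (rule cod.category_slice)
  interpret c: category "slice C y" by (rule dom.category_slice)
  show ?thesis
  proof unfold_locales
    fix f x z assume "f \<in> Hom (slice A (FO U y)) x z"
    then show "FA (disc_slice y) f \<in> Hom (slice C y) (FO (disc_slice y) x) (FO (disc_slice y) z)"
      using y by (cases f) (auto simp: Hom_def)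
  next
    fix x assume "x \<in> Obj (slice A (FO U y))"
    then show "FA (disc_slice y) (Ide (slice A (FO U y)) x) = Ide (slice C y) (FO (disc_slice y) x)"
      using y by simp
  next
    fix f x z g w assume "f \<in> Hom (slice A (FO U y)) x z" "g \<in> Hom (slice A (FO U y)) z w"
    then show "FA (disc_slice y) (g \<cdot>\<^bsub>slice A (FO U y)\<^esub> f) =
        FA (disc_slice y) g \<cdot>\<^bsub>slice C y\<^esub> FA (disc_slice y) f"
      using y by (cases f; cases g) (auto simp: Hom_def)
  next
    fix f x z assume "f \<in> Hom (slice C y) x z"
    then show "FA U_slice f \<in> Hom (slice A (FO U y)) (FO U_slice x) (FO U_slice z)"
      using y by (cases f) (auto simp: Hom_def simp flip: map_comp_arr)
  next
    fix f x z g w assume "f \<in> Hom (slice C y) x z" "g \<in> Hom (slice C y) z w"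
    then show "FA U_slice (g \<cdot>\<^bsub>slice C y\<^esub> f) = FA U_slice g \<cdot>\<^bsub>slice A (FO U y)\<^esub> FA U_slice f"
      by (cases f; cases g) (auto simp: Hom_def map_comp_arr)
  next
    have "slice_counit k \<in> Hom (slice C y) (lift (FA U k) y) k" if "k \<in> Obj (slice C y)" for k
      using that by (auto simp: slice_counit_def Hom_def)
    moreover have "slice_counit (Cod (slice C y) t) \<cdot>\<^bsub>slice C y\<^esub> FA (disc_slice y) (FA U_slice t) =
        t \<cdot>\<^bsub>slice C y\<^esub> slice_counit (Dom (slice C y) t)" if "t \<in> Arr (slice C y)" for t
      using that by (cases t) (auto simp: slice_counit_def map_comp_arr)
    ultimately show "nat_trans (slice C y) (slice C y) (disc_slice y \<bullet> U_slice) id_functor slice_counit"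
      by (simp add: nat_trans_def)
  next
    fix f assume "f \<in> Arr (slice A (FO U y))"
    then show "FA U_slice (FA (disc_slice y) f) = f"
      using y by (cases f) auto
  next
    fix x assume "x \<in> Obj (slice A (FO U y))"
    then show "slice_counit (FO (disc_slice y) x) = Ide (slice C y) (FO (disc_slice y) x)"
      using y by (simp add: slice_counit_def)
  qed (use y in \<open>auto simp: slice_counit_def\<close>)
qed

text \<open>Cones with apex \<open>z\<close> over the cospan in \<open>A\<close> lift to cones with apex \<open>disc z\<close> over the cospan
  in \<open>C\<close>, and so do the factorizations.\<close>

lemma pullback_of_lift:
  assumes p: "p \<in> Arr C" and f: "f \<in> Arr A" "Cod A f = FO U (Cod C p)"
    and pb: "is_pullback C p (lift f (Cod C p)) q r"
  shows "is_pullback A (FA U p) f (FA U q) (FA U r)"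
proof -
  let ?f = "lift f (Cod C p)"
  have q: "q \<in> Arr C" "Cod C q = Dom C p" and r: "r \<in> Arr C" "Dom C r = Dom C q"
      "Cod C r = disc (Dom A f)"
    and sq: "p \<cdot>\<^bsub>C\<^esub> q = ?f \<cdot>\<^bsub>C\<^esub> r"
    and univ: "\<And>z u v. z \<in> Obj C \<Longrightarrow> u \<in> Hom C z (Dom C p) \<Longrightarrow> v \<in> Hom C z (disc (Dom A f)) \<Longrightarrow>
      p \<cdot>\<^bsub>C\<^esub> u = ?f \<cdot>\<^bsub>C\<^esub> v \<Longrightarrow> \<exists>!w. w \<in> Hom C z (Dom C q) \<and> q \<cdot>\<^bsub>C\<^esub> w = u \<and> r \<cdot>\<^bsub>C\<^esub> w = v"
    using pb p f by (auto simp: is_pullback_def Hom_def)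
  have "FA U p \<cdot>\<^bsub>A\<^esub> FA U q = f \<cdot>\<^bsub>A\<^esub> FA U r"
    using arg_cong [OF sq, of "FA U"] p f q r by (simp add: map_comp_arr)
  moreover have factor: "\<exists>!w. w \<in> Hom A z (FO U (Dom C q)) \<and> FA U q \<cdot>\<^bsub>A\<^esub> w = u \<and> FA U r \<cdot>\<^bsub>A\<^esub> w = v"
    if z: "z \<in> Obj A" and u': "u \<in> Hom A z (FO U (Dom C p))" and v': "v \<in> Hom A z (Dom A f)"
      and eq: "FA U p \<cdot>\<^bsub>A\<^esub> u = f \<cdot>\<^bsub>A\<^esub> v" for z u v
  proof -
    let ?u = "lift u (Dom C p)" and ?v = "lift v (disc (Dom A f))"
    have u: "u \<in> Arr A" "Dom A u = z" "Cod A u = FO U (Dom C p)"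
      and v: "v \<in> Arr A" "Dom A v = z" "Cod A v = Dom A f"
      using u' v' by (auto simp: Hom_def)
    have "p \<cdot>\<^bsub>C\<^esub> ?u = ?f \<cdot>\<^bsub>C\<^esub> ?v"
      by (rule arr_eqI) (use p f u v eq in \<open>simp_all add: map_comp_arr\<close>)
    then have ex1: "\<exists>!w. w \<in> Hom C (disc z) (Dom C q) \<and> q \<cdot>\<^bsub>C\<^esub> w = ?u \<and> r \<cdot>\<^bsub>C\<^esub> w = ?v"
      by (intro univ) (use p f u v z in \<open>simp_all add: Hom_def\<close>)
    then obtain w where w: "w \<in> Arr C" "Dom C w = disc z" "Cod C w = Dom C q"
        "q \<cdot>\<^bsub>C\<^esub> w = ?u" "r \<cdot>\<^bsub>C\<^esub> w = ?v"
      by (auto simp: Hom_def)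
    show ?thesis
    proof (rule ex1I [of _ "FA U w"])
      have "FA U (q \<cdot>\<^bsub>C\<^esub> w) = u" "FA U (r \<cdot>\<^bsub>C\<^esub> w) = v"
        using p f u v by (simp_all add: w)
      then show "FA U w \<in> Hom A z (FO U (Dom C q)) \<and> FA U q \<cdot>\<^bsub>A\<^esub> FA U w = u \<and> FA U r \<cdot>\<^bsub>A\<^esub> FA U w = v"
        using z w(1-3) q r by (simp add: Hom_def map_comp_arr)
    next
      fix w' assume "w' \<in> Hom A z (FO U (Dom C q)) \<and> FA U q \<cdot>\<^bsub>A\<^esub> w' = u \<and> FA U r \<cdot>\<^bsub>A\<^esub> w' = v"
      then have w': "w' \<in> Arr A" "Dom A w' = z" "Cod A w' = FO U (Dom C q)"
          "FA U q \<cdot>\<^bsub>A\<^esub> w' = u" "FA U r \<cdot>\<^bsub>A\<^esub> w' = v"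
        by (auto simp: Hom_def)
      let ?w = "lift w' (Dom C q)"
      have "q \<cdot>\<^bsub>C\<^esub> ?w = ?u"
        by (rule arr_eqI) (use p q u w' in \<open>simp_all add: map_comp_arr\<close>)
      moreover have "r \<cdot>\<^bsub>C\<^esub> ?w = ?v"
        by (rule arr_eqI) (use f q r v w' in \<open>simp_all add: map_comp_arr\<close>)
      moreover have "?w \<in> Hom C (disc z) (Dom C q)"
        using q w' by (simp add: Hom_def)
      ultimately have "?w = w"
        using ex1 w by (auto simp: Hom_def)
      moreover have "FA U ?w = w'"
        using q w' by simp
      ultimately show "w' = FA U w" by simp
    qed
  qed
  ultimately show ?thesis
    unfolding is_pullback_def
  proof (intro conjI ballI impI)
    fix z u v assume "z \<in> Obj A" "u \<in> Hom A z (Dom A (FA U p))" "v \<in> Hom A z (Dom A f)"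
      "FA U p \<cdot>\<^bsub>A\<^esub> u = f \<cdot>\<^bsub>A\<^esub> v"
    then show "\<exists>!w. w \<in> Hom A z (Dom A (FA U q)) \<and> FA U q \<cdot>\<^bsub>A\<^esub> w = u \<and> FA U r \<cdot>\<^bsub>A\<^esub> w = v"
      using factor [of z u v] p q by simp
  qed (use p f q r in \<open>simp_all add: Hom_def\<close>)
qed

end

text \<open>The additional assumption says that an object with an arrow to a discrete object is itself
  discrete: the arrow \<open>k\<close> over the identity is inverse to the counit \<open>disc (U x) \<rightarrow> x\<close>, by
  faithfulness of \<open>U\<close>.\<close>

locale source_closed_discrete_objects = discrete_objects +
  assumes disc_source: "h \<in> Hom C x (disc a) \<Longrightarrow> a \<in> Obj A \<Longrightarrow>
      \<exists>k \<in> Hom C x (disc (FO U x)). FA U k = Ide A (FO U x)"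
begin

lemma slice_discreteI:
  assumes w: "w \<in> Arr C" and h: "h \<in> Hom C (Dom C w) (disc a)" and a: "a \<in> Obj A"
  shows "is_iso (slice C (Cod C w)) (slice_counit w)"
proof -
  interpret slice: category "slice C (Cod C w)" by (rule dom.category_slice)
  let ?x = "Dom C w"
  obtain k where k: "k \<in> Arr C" "Dom C k = ?x" "Cod C k = disc (FO U ?x)"
    "FA U k = Ide A (FO U ?x)"
    using disc_source [OF h a] by (auto simp: Hom_def)
  let ?i = "lift (FA U w) (Cod C w)" and ?d = "lift (Ide A (FO U ?x)) ?x"
  have 1: "?i \<cdot>\<^bsub>C\<^esub> k = w" by (rule arr_eqI) (use w k in \<open>simp_all add: map_comp_arr\<close>)
  have 2: "w \<cdot>\<^bsub>C\<^esub> ?d = ?i" by (rule arr_eqI) (use w in \<open>simp_all add: map_comp_arr\<close>)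
  have 3: "k \<cdot>\<^bsub>C\<^esub> ?d = Ide C (disc (FO U ?x))"
    by (rule arr_eqI) (use w k in \<open>simp_all add: map_comp_arr\<close>)
  have 4: "?d \<cdot>\<^bsub>C\<^esub> k = Ide C ?x"
    by (rule arr_eqI) (use w k in \<open>simp_all add: map_comp_arr\<close>)
  show ?thesis
    by (rule slice.isoI [where j = "(w, k, ?i)"])
      (use w k in \<open>simp_all add: slice_counit_def 1 2 3 4\<close>)
qed

text \<open>For \<open>p\<^sup>*\<close> to preserve discreteness, the apex of the pullback of a discrete object over \<open>y\<close>
  must be discrete. The counit at \<open>z\<close> is a triangle over \<open>y\<close> whose underlying arrow \<open>t\<close> goes from
  this apex to the source of \<open>z\<close>, so that closure under sources applies.\<close>

theorem preserves_effective_descent: "preserves_effective_descent C A U"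
  unfolding preserves_effective_descent_def
proof (intro allI impI)
  fix p assume ed: "effective_descent C p"
  then obtain R \<eta> \<epsilon> where p: "p \<in> Arr C"
    and pb: "\<And>f. f \<in> Arr C \<Longrightarrow> Cod C f = Cod C p \<Longrightarrow> \<exists>q r. is_pullback C p f q r"
    and mon: "monadic_adjunction (slice C (Dom C p)) (slice C (Cod C p)) (postcomp C p) R \<eta> \<epsilon>"
    by (auto simp: effective_descent_def)
  let ?x = "Dom C p" and ?y = "Cod C p" and ?p = "FA U p"
  interpret cx: coreflection "slice A (FO U ?x)" "slice C ?x" "disc_slice ?x" U_slice slice_counit
    by (rule coreflection_slice) (use p in simp)
  interpret cy: coreflection "slice A (FO U ?y)" "slice C ?y" "disc_slice ?y" U_slice slice_counit
    by (rule coreflection_slice) (use p in simp)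
  interpret adj: adjoint_pair "slice C ?x" "slice C ?y" "postcomp C p" R \<eta> \<epsilon>
    by unfold_locales (use mon in \<open>simp add: monadic_adjunction_def\<close>)
  interpret L0: is_functor "slice A (FO U ?x)" "slice A (FO U ?y)" "postcomp A ?p"
    using cod.postcomp_functor [of ?p] p by simp
  interpret restricted_adjunction
    "slice A (FO U ?x)" "slice C ?x" "disc_slice ?x" U_slice slice_counit
    "slice A (FO U ?y)" "slice C ?y" "disc_slice ?y" U_slice slice_counit
    "postcomp C p" R \<eta> \<epsilon> "postcomp A ?p"
  proof unfold_locales
    fix f assume "f \<in> Obj (slice A (FO U ?x))"
    then show "FO (postcomp C p) (FO (disc_slice ?x) f) = FO (disc_slice ?y) (FO (postcomp A ?p) f)"
      using p by auto
  next
    fix t assume "t \<in> Arr (slice A (FO U ?x))"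
    then show "FA (postcomp C p) (FA (disc_slice ?x) t) = FA (disc_slice ?y) (FA (postcomp A ?p) t)"
      using p by (cases t) auto
  next
    fix w assume "w \<in> Obj (slice C ?x)"
    then show "FO U_slice (FO (postcomp C p) w) = FO (postcomp A ?p) (FO U_slice w)"
      using p by (simp add: map_comp_arr)
  next
    fix t assume "t \<in> Arr (slice C ?x)"
    then show "FA U_slice (FA (postcomp C p) t) = FA (postcomp A ?p) (FA U_slice t)"
      using p by (cases t) (auto simp: map_comp_arr)
  next
    fix w assume "w \<in> Obj (slice C ?x)"
    then show "FA (postcomp C p) (slice_counit w) = slice_counit (FO (postcomp C p) w)"
      using p by (auto simp: slice_counit_def map_comp_arr)
  next
    fix z assume d: "cy.discrete z"
    then have z: "z \<in> Arr C" "Cod C z = ?y" and i: "is_iso (slice C ?y) (slice_counit z)"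
      by (auto simp: cy.discrete_def)
    obtain j where "j \<in> Arr (slice C ?y)" "Dom (slice C ?y) j = z"
        "Cod (slice C ?y) j = lift (FA U z) ?y"
      by (rule cy.I.cod.iso_inverse [OF i]) (use z in \<open>simp add: slice_counit_def\<close>)
    then obtain s where "s \<in> Arr C" "Dom C s = Dom C z" "Cod C s = Dom C (lift (FA U z) ?y)"
      by (cases j) auto
    then have s: "s \<in> Arr C" "Dom C s = Dom C z" "Cod C s = disc (FO U (Dom C z))"
      using z p by simp_all
    have w: "FO R z \<in> Arr C" "Cod C (FO R z) = ?x"
      using adj.R.map_obj [of z] z by auto
    have "\<epsilon> z \<in> Hom (slice C ?y) (p \<cdot>\<^bsub>C\<^esub> FO R z) z"
      using adj.counit_simps [of z] z by (simp add: Hom_def)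
    then obtain t where t: "t \<in> Arr C" "Dom C t = Dom C (FO R z)" "Cod C t = Dom C z"
      using p w by (cases "\<epsilon> z") (auto simp: Hom_def)
    have "is_iso (slice C (Cod C (FO R z))) (slice_counit (FO R z))"
      by (rule slice_discreteI [where h = "s \<cdot>\<^bsub>C\<^esub> t" and a = "FO U (Dom C z)"])
        (use s t w z in \<open>simp_all add: Hom_def\<close>)
    then show "cx.discrete (FO R z)"
      using w by (simp add: cx.discrete_def)
  qed
  have "\<exists>q r. is_pullback A ?p f q r" if f_arr: "f \<in> Arr A" and f_cod: "Cod A f = Cod A ?p" for f
  proof -
    have f: "Cod A f = FO U ?y"
      using f_cod p by simp
    obtain q r where "is_pullback C p (lift f ?y) q r"
      using pb [of "lift f ?y"] p f_arr f by auto
    from pullback_of_lift [OF p f_arr f this] show ?thesis by blast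
  qed
  moreover have "monadic_adjunction (slice A (Dom A ?p)) (slice A (Cod A ?p)) (postcomp A ?p) R0 \<eta>0 \<epsilon>0"
    using restricted_monadic [OF mon] p by simp
  ultimately show "effective_descent A ?p"
    using p unfolding effective_descent_def by auto
qed

end

section \<open>Bottom elements and discrete objects\<close>

text \<open>The discrete object over \<open>a\<close> is the initial lift of the source of all arrows from \<open>a\<close> to
  objects in the image of \<open>U\<close>.\<close>

lemma topological_discrete_objects:
  assumes "topological_functor C A U"
  obtains disc where "discrete_objects C A U disc"
proof -
  have U: "is_functor C A U" and faithful: "faithful C U"
    and lifts: "\<And>a S. structured_source C A U a S \<Longrightarrow> \<exists>X g. initial_lift C A U a S X g"
    using assms by (auto simp: topological_functor_def)
  interpret U: is_functor C A U by (rule U)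
  have "\<forall>a \<in> Obj A. \<exists>X. X \<in> Obj C \<and> FO U X = a \<and>
      (\<forall>y \<in> Obj C. \<forall>f \<in> Hom A a (FO U y). \<exists>g \<in> Hom C X y. FA U g = f)"
  proof
    fix a assume a: "a \<in> Obj A"
    let ?S = "{(y, f). y \<in> Obj C \<and> f \<in> Hom A a (FO U y)}"
    obtain X g where "initial_lift C A U a ?S X g"
      using lifts [of a ?S] a by (auto simp: structured_source_def)
    then have "X \<in> Obj C \<and> FO U X = a" and "\<And>y f. y \<in> Obj C \<Longrightarrow> f \<in> Hom A a (FO U y) \<Longrightarrow>
        g (y, f) \<in> Hom C X y \<and> FA U (g (y, f)) = f"
      unfolding initial_lift_def by auto
    then show "\<exists>X. X \<in> Obj C \<and> FO U X = a \<and>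
        (\<forall>y \<in> Obj C. \<forall>f \<in> Hom A a (FO U y). \<exists>g \<in> Hom C X y. FA U g = f)"
      by blast
  qed
  from bchoice [OF this] obtain disc where disc: "\<forall>a \<in> Obj A. disc a \<in> Obj C \<and> FO U (disc a) = a \<and>
      (\<forall>y \<in> Obj C. \<forall>f \<in> Hom A a (FO U y). \<exists>g \<in> Hom C (disc a) y. FA U g = f)" ..
  have "discrete_objects C A U disc"
  proof unfold_locales
    fix f a y assume f: "f \<in> Hom A a (FO U y)" and y: "y \<in> Obj C"
    then have "a \<in> Obj A"
      by (auto simp: Hom_def)
    with disc f y show "\<exists>g \<in> Hom C (disc a) y. FA U g = f" by blast
  qed (use disc faithful in auto)
  then show ?thesis by (rule that)
qed

lemma (in category) thin_initialI:
  assumes "thin C" and "x \<in> Obj C" and "\<And>y. y \<in> Obj C \<Longrightarrow> Hom C x y \<noteq> {}"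
  shows "initial_object C x"
  unfolding initial_object_def
proof (intro conjI ballI)
  fix y assume "y \<in> Obj C"
  then obtain f where f: "f \<in> Hom C x y"
    using assms(3) by blast
  show "\<exists>!f. f \<in> Hom C x y"
  proof (rule ex1I, rule f)
    fix g assume "g \<in> Hom C x y"
    with f assms(1) show "g = f"
      by (simp add: thin_def Hom_def)
  qed
qed (rule assms(2))

lemma grothendieck_simps [simp]:
  "(a, x) \<in> Obj (grothendieck A F) \<longleftrightarrow> a \<in> Obj A \<and> x \<in> Obj (Fib F a)"
  "((a, x), (f, \<phi>), (b, y)) \<in> Arr (grothendieck A F) \<longleftrightarrow>
     a \<in> Obj A \<and> x \<in> Obj (Fib F a) \<and> b \<in> Obj A \<and> y \<in> Obj (Fib F b) \<and>
     f \<in> Hom A a b \<and> \<phi> \<in> Hom (Fib F a) x (FO (Rex F f) y)"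
  "Dom (grothendieck A F) (X, h, Y) = X" "Cod (grothendieck A F) (X, h, Y) = Y"
  "FO grothendieck_proj X = fst X" "FA grothendieck_proj (X, (f, \<phi>), Y) = f"
  by (auto simp: grothendieck_def grothendieck_proj_def)

lemma grothendieck_arr_obtain:
  assumes "Dom (grothendieck A F) m = X" and "Cod (grothendieck A F) m = Y"
  obtains f \<phi> where "m = (X, (f, \<phi>), Y)"
  using that assms by (cases m) auto

text \<open>Across the equivalence \<open>E : C \<rightarrow> \<integral> F\<close> with quasi-inverse \<open>G\<close>, the object \<open>disc e\<close> becomes a
  pair \<open>(e, y)\<close>, and the lifts of the identity of \<open>e\<close> to arrows \<open>disc e \<rightarrow> G (e, y')\<close> show that
  \<open>y\<close> is a bottom element of its fiber. The arrow \<open>h\<close> over \<open>f\<close> puts the fiber component \<open>x'\<close> of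
  \<open>x\<close> below the reindexing of \<open>y\<close> along \<open>f\<close>, which is a bottom element by assumption and hence lies
  below the fiber component \<open>d\<close> of \<open>disc (U x)\<close>. The resulting arrow \<open>E x \<rightarrow> E (disc (U x))\<close> over the
  identity is transported back to \<open>C\<close>.\<close>

lemma (in discrete_objects) grothendieck_source_closed:
  fixes F :: "('o, 'a, 'x, 'm) pseudo"
  assumes F: "pseudofunctor A F"
    and thin: "\<And>a. a \<in> Obj A \<Longrightarrow> thin (Fib F a)"
    and eq: "equivalent_over A C (grothendieck A F) U grothendieck_proj"
    and bottom: "\<And>f a b. f \<in> Hom A a b \<Longrightarrow>
      preserves_initial_objects (Fib F b) (Fib F a) (Rex F f)"
    and h: "h \<in> Hom C x (disc e)" and e: "e \<in> Obj A"
  shows "\<exists>k \<in> Hom C x (disc (FO U x)). FA U k = Ide A (FO U x)"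
proof -
  interpret F: pseudofunctor A F by (rule F)
  let ?G = "grothendieck A F" and ?V = "grothendieck_proj ::
    ('o \<times> 'x, ('o \<times> 'x) \<times> ('a \<times> 'm) \<times> ('o \<times> 'x), 'o, 'a) fctr"
  obtain E G \<sigma> \<tau> where V: "is_functor ?G A ?V" and E: "is_functor C ?G E" and G: "is_functor ?G C G"
    and VE: "functor_eq C (?V \<bullet> E) U" and UG: "functor_eq ?G (U \<bullet> G) ?V"
    and \<sigma>: "nat_iso C C (G \<bullet> E) id_functor \<sigma>" and \<tau>: "nat_iso ?G ?G (E \<bullet> G) id_functor \<tau>"
    and U\<sigma>: "\<forall>x \<in> Obj C. FA U (\<sigma> x) = Ide A (FO U x)"
    and V\<tau>: "\<forall>Y \<in> Obj ?G. FA ?V (\<tau> Y) = Ide A (FO ?V Y)"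
    using eq unfolding equivalent_over_def by (elim conjE exE) (rule that)
  interpret V: is_functor ?G A ?V by (rule V)
  interpret E: is_functor C ?G E by (rule E)
  interpret G: is_functor ?G C G by (rule G)
  have VE_obj: "fst (FO E z) = FO U z" if "z \<in> Obj C" for z
    using VE that by (simp add: functor_eq_def)
  have VE_arr: "FA ?V (FA E f) = FA U f" if "f \<in> Arr C" for f
    using VE that by (simp add: functor_eq_def)
  have UG_obj: "FO U (FO G Y) = fst Y" if "Y \<in> Obj ?G" for Y
    using UG that by (simp add: functor_eq_def)
  have UG_arr: "FA U (FA G m) = FA ?V m" if "m \<in> Arr ?G" for m
    using UG that by (simp add: functor_eq_def)
  have E_obj: "\<exists>w. FO E z = (FO U z, w) \<and> w \<in> Obj (Fib F (FO U z))" if z: "z \<in> Obj C" for z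
  proof -
    obtain b w where bw: "FO E z = (b, w)"
      by (cases "FO E z")
    moreover have "FO E z \<in> Obj ?G"
      using z by simp
    ultimately show ?thesis
      using VE_obj [OF z] by simp
  qed

  obtain y where E_disc: "FO E (disc e) = (e, y)" and y: "y \<in> Obj (Fib F e)"
    using E_obj [of "disc e"] e by auto
  interpret fib_e: category "Fib F e" by (rule F.fib_category [OF e])
  have "initial_object (Fib F e) y"
  proof (rule fib_e.thin_initialI [OF thin [OF e] y])
    fix y' assume y': "y' \<in> Obj (Fib F e)"
    let ?Y = "(e, y')"
    have Y: "?Y \<in> Obj ?G"
      using e y' by simp
    let ?g = "lift (Ide A e) (FO G ?Y)"
    have g: "?g \<in> Arr C" "Dom C ?g = disc e" "Cod C ?g = FO G ?Y" "FA U ?g = Ide A e"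
      using e Y UG_obj [OF Y] by simp_all
    have \<tau>Y: "\<tau> ?Y \<in> Arr ?G" "Dom ?G (\<tau> ?Y) = FO E (FO G ?Y)" "Cod ?G (\<tau> ?Y) = ?Y"
      using \<tau> Y by (auto simp: nat_iso_def nat_trans_def Hom_def)
    define m where "m = \<tau> ?Y \<cdot>\<^bsub>?G\<^esub> FA E ?g"
    have m: "m \<in> Arr ?G" "Dom ?G m = (e, y)" "Cod ?G m = ?Y"
      using g \<tau>Y by (simp_all add: m_def E_disc)
    have "FA ?V m = FA ?V (\<tau> ?Y) \<cdot>\<^bsub>A\<^esub> FA ?V (FA E ?g)"
      unfolding m_def by (rule V.map_comp_arr) (use g \<tau>Y in simp_all)
    then have Vm: "FA ?V m = Ide A e"
      using e g VE_arr [of ?g] V\<tau> Y by simp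
    obtain f \<phi> where m_eq: "m = ((e, y), (f, \<phi>), ?Y)"
      by (rule grothendieck_arr_obtain [OF m(2,3)])
    then have "f = Ide A e"
      using Vm by simp
    then have \<phi>: "\<phi> \<in> Hom (Fib F e) y (FO (Rex F (Ide A e)) y')"
      using m(1) by (simp add: m_eq)
    have u: "is_iso (Fib F e) (Unt F e y')"
        "Unt F e y' \<in> Hom (Fib F e) y' (FO (Rex F (Ide A e)) y')"
      using F.unt_iso [OF e] y' by (auto simp: nat_iso_def nat_trans_def)
    \<comment> \<open>\<open>\<phi>\<close> ends at the reindexing of \<open>y'\<close> along the identity, which is only isomorphic to \<open>y'\<close>.\<close>
    obtain j where j: "j \<in> Hom (Fib F e) (FO (Rex F (Ide A e)) y') y'"
      by (rule fib_e.iso_inverse [OF u(1)]) (use u(2) in \<open>auto simp: Hom_def\<close>)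
    show "Hom (Fib F e) y y' \<noteq> {}"
      using fib_e.comp_hom [OF \<phi> j] by blast
  qed

  have h': "h \<in> Arr C" "Dom C h = x" "Cod C h = disc e" and x: "x \<in> Obj C"
    using h by (auto simp: Hom_def)
  let ?a = "FO U x"
  have a: "?a \<in> Obj A"
    using x by simp
  interpret fib_a: category "Fib F ?a" by (rule F.fib_category [OF a])
  obtain x' where E_x: "FO E x = (?a, x')" and x': "x' \<in> Obj (Fib F ?a)"
    using E_obj [OF x] by auto
  obtain d where E_disc_a: "FO E (disc ?a) = (?a, d)" and d: "d \<in> Obj (Fib F ?a)"
    using E_obj [of "disc ?a"] a by auto
  obtain f \<phi> where "FA E h = ((?a, x'), (f, \<phi>), (e, y))"
    by (rule grothendieck_arr_obtain [of A F "FA E h"]) (use h' in \<open>simp_all add: E_disc E_x\<close>)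
  moreover have "FA E h \<in> Arr ?G"
    using h' by simp
  ultimately have f: "f \<in> Hom A ?a e" and \<phi>: "\<phi> \<in> Hom (Fib F ?a) x' (FO (Rex F f) y)"
    by simp_all
  interpret R: is_functor "Fib F ?a" "Fib F ?a" "Rex F (Ide A ?a)"
    using F.rex_functor [OF cod.ide_hom [OF a]] .
  have "initial_object (Fib F ?a) (FO (Rex F f) y)"
    using bottom [OF f] \<open>initial_object (Fib F e) y\<close> by (simp add: preserves_initial_objects_def)
  moreover have "FO (Rex F (Ide A ?a)) d \<in> Obj (Fib F ?a)"
    using d by simp
  ultimately obtain \<psi> where \<psi>: "\<psi> \<in> Hom (Fib F ?a) (FO (Rex F f) y) (FO (Rex F (Ide A ?a)) d)"
    unfolding initial_object_def by blast
  define m where "m = ((?a, x'), (Ide A ?a, \<psi> \<cdot>\<^bsub>Fib F ?a\<^esub> \<phi>), (?a, d))"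
  have m: "m \<in> Arr ?G" "Dom ?G m = FO E x" "Cod ?G m = FO E (disc ?a)" "FA ?V m = Ide A ?a"
    using x' a d fib_a.comp_hom [OF \<phi> \<psi>] cod.ide_hom [OF a] by (simp_all add: m_def E_x E_disc_a)

  have \<sigma>z: "is_iso C (\<sigma> z)" "\<sigma> z \<in> Arr C" "Dom C (\<sigma> z) = FO G (FO E z)" "Cod C (\<sigma> z) = z"
    if "z \<in> Obj C" for z
    using \<sigma> that by (auto simp: nat_iso_def nat_trans_def Hom_def)
  obtain j where j: "j \<in> Arr C" "Dom C j = x" "Cod C j = FO G (FO E x)"
      "\<sigma> x \<cdot>\<^bsub>C\<^esub> j = Ide C x"
    by (rule dom.iso_inverse [OF \<sigma>z(1) [OF x]]) (use \<sigma>z [OF x] in auto)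
  have "FA U (\<sigma> x \<cdot>\<^bsub>C\<^esub> j) = Ide A ?a"
    using j(4) x by simp
  moreover have "FO U (FO G (FO E x)) = ?a"
    using UG_obj [of "FO E x"] VE_obj [OF x] x by simp
  ultimately have Uj: "FA U j = Ide A ?a"
    using j(1-3) x \<sigma>z [OF x] U\<sigma> by (simp add: map_comp_arr)
  let ?s = "\<sigma> (disc ?a)"
  have s: "?s \<in> Arr C" "Dom C ?s = FO G (FO E (disc ?a))" "Cod C ?s = disc ?a"
      "FA U ?s = Ide A ?a"
    using \<sigma>z [of "disc ?a"] U\<sigma> a by simp_all
  have "FA U (?s \<cdot>\<^bsub>C\<^esub> (FA G m \<cdot>\<^bsub>C\<^esub> j)) = Ide A ?a"
    using s j(1-3) Uj m UG_arr [OF m(1)] a by (simp add: map_comp_arr)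
  moreover have "?s \<cdot>\<^bsub>C\<^esub> (FA G m \<cdot>\<^bsub>C\<^esub> j) \<in> Hom C x (disc ?a)"
    using s j(1-3) m by (simp add: Hom_def)
  ultimately show ?thesis by blast
qed

theorem lemma27:
  fixes C :: "('p, 'b) cat" and A :: "('o, 'a) cat"
    and U :: "('p, 'b, 'o, 'a) fctr"
    and F :: "('o, 'a, 'x, 'm) pseudo"
  assumes "topological_functor C A U"
    and "pseudofunctor A F"
    and "bifibration A F"
    and "\<And>a. a \<in> Obj A \<Longrightarrow> complete_thin (Fib F a)"
    and "equivalent_over A C (grothendieck A F) U grothendieck_proj"
    and "\<And>f a b. f \<in> Hom A a b \<Longrightarrow>
           preserves_initial_objects (Fib F b) (Fib F a) (Rex F f)"
  shows "preserves_effective_descent C A U"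
proof -
  obtain disc where "discrete_objects C A U disc"
    by (rule topological_discrete_objects [OF assms(1)])
  then interpret discrete_objects C A U disc .
  have thin: "thin (Fib F a)" if "a \<in> Obj A" for a
    using assms(4) [OF that] by (simp add: complete_thin_def)
  interpret source_closed_discrete_objects C A U disc
    by unfold_locales (rule grothendieck_source_closed [OF assms(2) thin assms(5,6)])
  show ?thesis
    by (rule preserves_effective_descent)
qed
end
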